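(* Assume that $\mu$ satisfies (A1)--(A3), and let $W\subset V$ be a finite-dimensional subspace. Let $\mathbf{u}^\star$ be the unique minimiser of $\mathsf{E}$ in $W$, let $\mathbf{u}^0\in W$ be arbitrary, and let $\{\mathbf{u}^n\}_{n\ge0}\subset W$ be the sequence generated by the Kačanov iteration on $W$. Then $$0\leq\mathsf{E}(\mathbf{u}^{n+1})-\mathsf{E}(\mathbf{u}^\star)\leq q_A(n)\left(\mathsf{E}(\mathbf{u}^n)-\mathsf{E}(\mathbf{u}^\star)\right)+o_W\left(|||\mathbf{u}^\star-\mathbf{u}^n|||_\Omega^2\right),$$ where $$q_A(n):=1-\frac14\left\{\operatorname*{ess\,sup}_{\boldsymbol{x}\in\Omega}\frac{\mu(|\underline{e}(\mathbf{u}^n)|^2)}{2\mu'(|\underline{e}(\mathbf{u}^n)|^2)|\underline{e}(\mathbf{u}^n)|^2+\mu(|\underline{e}(\mathbf{u}^n)|^2)}\right\}^{-1}.$$ Here $o_W(|||\mathbf{u}^\star-\mathbf{u}^n|||_\Omega^2)$ denotes a remainder $\rho_n\in\mathbb{R}$, which may depend on $W$, of higher order than $|||\mathbf{u}^\star-\mathbf{u}^n|||_\Omega^2$ as $n\to\infty$, i.e. for every $\epsilon>0$ there is $N$ such that $|\rho_n|\le\epsilon\,|||\mathbf{u}^\star-\mathbf{u}^n|||_\Omega^2$ for all $n\ge N$.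
   Context: Let $\Omega\subset\mathbb{R}^d$, $d\in\{2,3\}$, be a bounded Lipschitz domain and $\mathbf{f}\in \mathrm{L}^2(\Omega)^d$. For a vector field $\mathbf{u}$, $\underline{e}(\mathbf{u})$ is the $d\times d$ tensor with entries $e_{ij}(\mathbf{u})=\frac12\left(\frac{\partial u_i}{\partial x_j}+\frac{\partial u_j}{\partial x_i}\right)$; $|\cdot|$ denotes the Frobenius norm and $:$ the Frobenius inner product of $d\times d$ matrices. The viscosity $\mu=\mu(\boldsymbol{x},t)$ is real-valued and is assumed to satisfy: (A1) $\mu\in C(\overline\Omega\times\mathbb{R}_{\ge 0})$ and it is differentiable in the second variable; (A2) there exist constants $m_\mu,M_\mu>0$ such that $m_\mu(t-s)\le\mu(\boldsymbol{x},t^2)t-\mu(\boldsymbol{x},s^2)s\le M_\mu(t-s)$ for all $t\ge s\ge 0$ and $\boldsymbol{x}\in\overline\Omega$; (A3) $\mu$ is decreasing in the second variable, i.e. $\mu'(\boldsymbol{x},t)\le 0$ for all $t\ge 0$ and $\boldsymbol{x}\in\overline\Omega$. The prime denotes the derivative with respect to the second (scalar) variable, and the dependence of $\mu$ on $\boldsymbol{x}$ is suppressed in the notation; $\mu(t)$ stands for $\mu(\boldsymbol{x},t)$. Let $V:=\{\mathbf{u}\in \mathrm{H}^1_0(\Omega)^d:\nabla\cdot\mathbf{u}=0\}$, a Hilbert space with inner product $(\mathbf{u},\mathbf{v})_V=\int_\Omega\underline{e}(\mathbf{u}):\underline{e}(\mathbf{v})\,\mathrm{d}\boldsymbol{x}$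 and induced norm $|||\mathbf{u}|||_\Omega=(\mathbf{u},\mathbf{u})_V^{1/2}$. The energy functional (here restricted to $W$) is $$\mathsf{E}(\mathbf{u}):=\int_\Omega\varphi(|\underline{e}(\mathbf{u})|^2)\,\mathrm{d}\boldsymbol{x}-\int_\Omega\mathbf{f}\cdot\mathbf{u}\,\mathrm{d}\boldsymbol{x},\qquad \varphi(s):=\frac12\int_0^s\mu(t)\,\mathrm{d}t.$$ Under (A1)--(A3), $\mathsf{E}$ has a unique minimiser in $W$. Kačanov iteration on $W$: given $\mathbf{u}^0\in W$, for $n=0,1,\ldots$ let $\mathbf{u}^{n+1}\in W$ be the (unique) element with $\int_\Omega\mu(|\underline{e}(\mathbf{u}^n)|^2)\underline{e}(\mathbf{u}^{n+1}):\underline{e}(\mathbf{v})\,\mathrm{d}\boldsymbol{x}=\int_\Omega\mathbf{f}\cdot\mathbf{v}\,\mathrm{d}\boldsymbol{x}$ for all $\mathbf{v}\in W$.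
   Formalization: In (A1), "differentiable in the second variable" is strengthened to continuously differentiable in t for each fixed x in the closure of Ω; with bare differentiability the estimate can fail. *)

theory Defs
  imports "HOL-Analysis.Analysis" "HOL-Probability.Essential_Supremum"
begin

(* Near each boundary point the domain is the strict epigraph of a Lipschitz function over a
   hyperplane; the rotation of the usual definition is encoded by the unit normal nu, and
   x - (x . nu) nu is the orthogonal projection of x to the hyperplane. *)
definition bounded_lipschitz_domain :: "(real^'d) set \<Rightarrow> bool" where
  "bounded_lipschitz_domain \<Omega> \<longleftrightarrow>
     open \<Omega> \<and> connected \<Omega> \<and> \<Omega> \<noteq> {} \<and> bounded \<Omega> \<and>
     (\<forall>p\<in>frontier \<Omega>. \<exists>r>0. \<exists>\<nu> \<gamma> L. norm \<nu> = 1 \<and> L-lipschitz_on {y. y \<bullet> \<nu> = 0} \<gamma> \<and>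
        \<Omega> \<inter> ball p r = {x \<in> ball p r. \<gamma> (x - (x \<bullet> \<nu>) *\<^sub>R \<nu>) < x \<bullet> \<nu>})"


subsection \<open>Sobolev spaces\<close>

definition partial_deriv :: "'d \<Rightarrow> (real^'d \<Rightarrow> real) \<Rightarrow> real^'d \<Rightarrow> real" where
  "partial_deriv i g x = frechet_derivative g (at x) (axis i 1)"

primrec C_k :: "nat \<Rightarrow> (real^'d \<Rightarrow> real) \<Rightarrow> bool" where
  "C_k 0 g \<longleftrightarrow> continuous_on UNIV g"
| "C_k (Suc k) g \<longleftrightarrow> (\<forall>x. g differentiable (at x)) \<and> (\<forall>i. C_k k (partial_deriv i g))"

definition test_functions :: "(real^'d) set \<Rightarrow> (real^'d \<Rightarrow> real) set" where
  "test_functions \<Omega> = {\<psi>. (\<forall>k. C_k k \<psi>) \<and>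
     compact (closure {x. \<psi> x \<noteq> 0}) \<and> closure {x. \<psi> x \<noteq> 0} \<subseteq> \<Omega>}"

(* Elements of Lebesgue and Sobolev spaces are represented by functions on the whole space, of
   which only the values almost everywhere in \<Omega> matter; no quotient is taken. *)
definition L2 :: "(real^'d) set \<Rightarrow> (real^'d \<Rightarrow> 'b::euclidean_space) set" where
  "L2 \<Omega> = {g. g \<in> borel_measurable (lebesgue_on \<Omega>) \<and>
              integrable (lebesgue_on \<Omega>) (\<lambda>x. (norm (g x))\<^sup>2)}"

definition is_weak_partial ::
  "(real^'d) set \<Rightarrow> 'd \<Rightarrow> (real^'d \<Rightarrow> real) \<Rightarrow> (real^'d \<Rightarrow> real) \<Rightarrow> bool" where
  "is_weak_partial \<Omega> i u g \<longleftrightarrow> (\<forall>\<psi>\<in>test_functions \<Omega>.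
     (LINT x|lebesgue_on \<Omega>. u x * partial_deriv i \<psi> x) = - (LINT x|lebesgue_on \<Omega>. g x * \<psi> x))"

definition H1 :: "(real^'d) set \<Rightarrow> (real^'d \<Rightarrow> real) set" where
  "H1 \<Omega> = {u \<in> L2 \<Omega>. \<forall>i. \<exists>g \<in> L2 \<Omega>. is_weak_partial \<Omega> i u g}"

(* A representative of the weak derivative, which is determined only up to null sets. *)
definition weak_partial :: "(real^'d) set \<Rightarrow> 'd \<Rightarrow> (real^'d \<Rightarrow> real) \<Rightarrow> real^'d \<Rightarrow> real" where
  "weak_partial \<Omega> i u = (SOME g. g \<in> L2 \<Omega> \<and> is_weak_partial \<Omega> i u g)"

definition H1_0 :: "(real^'d) set \<Rightarrow> (real^'d \<Rightarrow> real) set" where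
  "H1_0 \<Omega> = {u \<in> H1 \<Omega>. \<exists>\<psi> :: nat \<Rightarrow> real^'d \<Rightarrow> real. (\<forall>k. \<psi> k \<in> test_functions \<Omega>) \<and>
     (\<lambda>k. LINT x|lebesgue_on \<Omega>. (u x - \<psi> k x)\<^sup>2) \<longlonglongrightarrow> 0 \<and>
     (\<forall>i. (\<lambda>k. LINT x|lebesgue_on \<Omega>.
              (weak_partial \<Omega> i u x - partial_deriv i (\<psi> k) x)\<^sup>2) \<longlonglongrightarrow> 0)}"


subsection \<open>Divergence-free fields\<close>

(* On real^'d^'d the library's inner product and norm are the Frobenius ones. *)
definition sym_grad :: "(real^'d) set \<Rightarrow> (real^'d \<Rightarrow> real^'d) \<Rightarrow> real^'d \<Rightarrow> real^'d^'d" where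
  "sym_grad \<Omega> u x = (\<chi> i j. (1/2) *
     (weak_partial \<Omega> j (\<lambda>y. u y $ i) x + weak_partial \<Omega> i (\<lambda>y. u y $ j) x))"

definition V :: "(real^'d) set \<Rightarrow> (real^'d \<Rightarrow> real^'d) set" where
  "V \<Omega> = {u. (\<forall>i. (\<lambda>x. u x $ i) \<in> H1_0 \<Omega>) \<and>
             (AE x in lebesgue_on \<Omega>. (\<Sum>i\<in>UNIV. weak_partial \<Omega> i (\<lambda>y. u y $ i) x) = 0)}"

definition V_inner ::
  "(real^'d) set \<Rightarrow> (real^'d \<Rightarrow> real^'d) \<Rightarrow> (real^'d \<Rightarrow> real^'d) \<Rightarrow> real" where
  "V_inner \<Omega> u v = (LINT x|lebesgue_on \<Omega>. sym_grad \<Omega> u x \<bullet> sym_grad \<Omega> v x)"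

definition V_norm :: "(real^'d) set \<Rightarrow> (real^'d \<Rightarrow> real^'d) \<Rightarrow> real" where
  "V_norm \<Omega> u = sqrt (V_inner \<Omega> u u)"

(* The spanning condition is modulo null sets, so W may be the full preimage of a
   finite-dimensional space of equivalence classes as well as a space of representatives. *)
definition finite_dim_subspace_V ::
  "(real^'d) set \<Rightarrow> (real^'d \<Rightarrow> real^'d) set \<Rightarrow> bool" where
  "finite_dim_subspace_V \<Omega> W \<longleftrightarrow>
     W \<subseteq> V \<Omega> \<and> (\<lambda>x. 0) \<in> W \<and>
     (\<forall>u\<in>W. \<forall>v\<in>W. (\<lambda>x. u x + v x) \<in> W) \<and>
     (\<forall>c. \<forall>u\<in>W. (\<lambda>x. c *\<^sub>R u x) \<in> W) \<and>
     (\<exists>B. finite B \<and> B \<subseteq> W \<and>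
        (\<forall>u\<in>W. \<exists>c. AE x in lebesgue_on \<Omega>. u x = (\<Sum>b\<in>B. c b *\<^sub>R b x)))"


subsection \<open>The viscosity\<close>

(* mu' is the derivative of mu in the second variable (one-sided at 0).
   Differentiability is understood as continuous differentiability in t for each fixed x; no joint
   continuity of mu' is required.  If mu' may be discontinuous in t, mu' along the iterates
   is unrelated to mu' at the minimiser and the contraction estimate can fail. *)
definition viscosity_A1 ::
  "(real^'d) set \<Rightarrow> (real^'d \<Rightarrow> real \<Rightarrow> real) \<Rightarrow> (real^'d \<Rightarrow> real \<Rightarrow> real) \<Rightarrow> bool" where
  "viscosity_A1 \<Omega> \<mu> \<mu>' \<longleftrightarrow>
     continuous_on (closure \<Omega> \<times> {0..}) (\<lambda>(x, t). \<mu> x t) \<and>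
     (\<forall>x\<in>closure \<Omega>. \<forall>t\<ge>0. (\<mu> x has_real_derivative \<mu>' x t) (at t within {0..})) \<and>
     (\<forall>x\<in>closure \<Omega>. continuous_on {0..} (\<mu>' x))"

definition viscosity_A2 :: "(real^'d) set \<Rightarrow> (real^'d \<Rightarrow> real \<Rightarrow> real) \<Rightarrow> bool" where
  "viscosity_A2 \<Omega> \<mu> \<longleftrightarrow> (\<exists>m>0. \<exists>M>0. \<forall>x\<in>closure \<Omega>. \<forall>s\<ge>0. \<forall>t\<ge>s.
     m * (t - s) \<le> \<mu> x (t\<^sup>2) * t - \<mu> x (s\<^sup>2) * s \<and>
     \<mu> x (t\<^sup>2) * t - \<mu> x (s\<^sup>2) * s \<le> M * (t - s))"

definition viscosity_A3 :: "(real^'d) set \<Rightarrow> (real^'d \<Rightarrow> real \<Rightarrow> real) \<Rightarrow> bool" where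
  "viscosity_A3 \<Omega> \<mu>' \<longleftrightarrow> (\<forall>x\<in>closure \<Omega>. \<forall>t\<ge>0. \<mu>' x t \<le> 0)"


subsection \<open>Energy and Kacanov iteration\<close>

definition energy_density :: "(real^'d \<Rightarrow> real \<Rightarrow> real) \<Rightarrow> real^'d \<Rightarrow> real \<Rightarrow> real" where
  "energy_density \<mu> x s = (1/2) * integral {0..s} (\<mu> x)"

definition energy ::
  "(real^'d) set \<Rightarrow> (real^'d \<Rightarrow> real \<Rightarrow> real) \<Rightarrow> (real^'d \<Rightarrow> real^'d) \<Rightarrow>
   (real^'d \<Rightarrow> real^'d) \<Rightarrow> real" where
  "energy \<Omega> \<mu> f u =
     (LINT x|lebesgue_on \<Omega>. energy_density \<mu> x ((norm (sym_grad \<Omega> u x))\<^sup>2))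
     - (LINT x|lebesgue_on \<Omega>. f x \<bullet> u x)"

definition kacanov_sequence ::
  "(real^'d) set \<Rightarrow> (real^'d \<Rightarrow> real \<Rightarrow> real) \<Rightarrow> (real^'d \<Rightarrow> real^'d) \<Rightarrow>
   (real^'d \<Rightarrow> real^'d) set \<Rightarrow> (nat \<Rightarrow> real^'d \<Rightarrow> real^'d) \<Rightarrow> bool" where
  "kacanov_sequence \<Omega> \<mu> f W u \<longleftrightarrow>
     (\<forall>n. u n \<in> W) \<and>
     (\<forall>n. \<forall>v\<in>W.
        (LINT x|lebesgue_on \<Omega>. \<mu> x ((norm (sym_grad \<Omega> (u n) x))\<^sup>2) *
            (sym_grad \<Omega> (u (Suc n)) x \<bullet> sym_grad \<Omega> v x))
        = (LINT x|lebesgue_on \<Omega>. f x \<bullet> v x))"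

(* The library's esssup needs a complete order, hence the detour through ereal.  Under (A1)-(A3)
   the ratio is measurable with values in [1, M/m], so the conversion back to real is harmless. *)
definition q_A ::
  "(real^'d) set \<Rightarrow> (real^'d \<Rightarrow> real \<Rightarrow> real) \<Rightarrow> (real^'d \<Rightarrow> real \<Rightarrow> real) \<Rightarrow>
   (real^'d \<Rightarrow> real^'d) \<Rightarrow> real" where
  "q_A \<Omega> \<mu> \<mu>' w = 1 - (1/4) * inverse (real_of_ereal (esssup (lebesgue_on \<Omega>) (\<lambda>x.
     let s = (norm (sym_grad \<Omega> w x))\<^sup>2 in ereal (\<mu> x s / (2 * \<mu>' x s * s + \<mu> x s)))))"

end

theory Submission
  imports Defs
begin

text \<open>Write \<open>\<phi>\<close> for the energy density, \<open>\<kappa>(t) = 2 \<mu>'(t\<^sup>2) t\<^sup>2 + \<mu>(t\<^sup>2)\<close> for the derivative of the flux \<open>\<mu>(t\<^sup>2) t\<close>,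
  and \<open>D\<close> for the excess energy of the iterate \<open>u\<close> with minimiser \<open>u*\<close> and \<open>w = u* - u\<close>.  Taylor's
  formula for \<open>\<phi>(t\<^sup>2)\<close> identifies the Bregman divergence of \<open>A \<mapsto> \<phi>(|A|\<^sup>2)\<close> as
  \<open>\<kappa>(\<xi>) (|B| - |A|)\<^sup>2 / 2 + \<mu>(|A|\<^sup>2) (|A||B| - A \<bullet> B)\<close>, so it lies between \<open>\<kappa>\<close> and \<open>\<mu>\<close> times
  \<open>|B - A|\<^sup>2 / 2\<close>.  As the Kacanov step minimises the quadratic majorant of the energy at \<open>u\<close>, testing
  with \<open>\<theta> w\<close> and using convexity gives \<open>D' \<le> D - \<theta> D + \<theta>\<^sup>2 a(w, w) / 2\<close>, where \<open>a\<close> is the form weighted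
  by \<open>\<mu>(|e(u)|\<^sup>2)\<close>.  With \<open>R\<close> the essential supremum of \<open>\<mu> / \<kappa>\<close>, the lower bound on the divergence
  yields \<open>a(w, w) \<le> 2 R (D + \<tau>)\<close>, where \<open>\<tau>\<close> is the error from evaluating \<open>\<kappa>\<close> at \<open>e(u)\<close> instead of
  \<open>\<xi>\<close>; \<open>\<theta> = 1/(2R)\<close> is the choice that produces \<open>1 - 1/(4R)\<close>.  The crude bound
  \<open>m \<le> \<kappa> \<le> \<mu> \<le> M\<close> in the same inequality gives \<open>D \<longlonglongrightarrow> 0\<close>, and then \<open>\<tau> = o(|||w|||\<^sup>2)\<close> by
  dominated convergence, the dominating function coming from the finite dimension of \<open>W\<close>.
  The load enters only through its linearity, so neither Korn's nor Poincare's inequality is needed.\<close>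

section \<open>Scalar estimates for the viscosity\<close>

definition flux_deriv :: "(real \<Rightarrow> real) \<Rightarrow> (real \<Rightarrow> real) \<Rightarrow> real \<Rightarrow> real" where
  "flux_deriv \<nu> \<nu>' t = 2 * \<nu>' (t\<^sup>2) * t\<^sup>2 + \<nu> (t\<^sup>2)"

definition potential :: "(real \<Rightarrow> real) \<Rightarrow> real \<Rightarrow> real" where
  "potential \<nu> s = (1/2) * integral {0..s} \<nu>"

definition bregman :: "(real \<Rightarrow> real) \<Rightarrow> 'e::real_inner \<Rightarrow> 'e \<Rightarrow> real" where
  "bregman \<nu> A B = potential \<nu> ((norm B)\<^sup>2) - potential \<nu> ((norm A)\<^sup>2) - \<nu> ((norm A)\<^sup>2) * (A \<bullet> (B - A))"

text \<open>The amount by which the divergence falls short of the quadratic whose coefficient is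
  taken at the end point \<open>B\<close>, where \<open>q_A\<close> evaluates it, instead of at an
  intermediate point. Truncation at 0 makes it nonnegative, so its integral can serve as the
  remainder.\<close>

definition bregman_defect :: "(real \<Rightarrow> real) \<Rightarrow> (real \<Rightarrow> real) \<Rightarrow> 'e::real_inner \<Rightarrow> 'e \<Rightarrow> real" where
  "bregman_defect \<nu> \<nu>' A B = max 0 ((1/2) * flux_deriv \<nu> \<nu>' (norm B) * (norm (B - A))\<^sup>2 - bregman \<nu> A B)"

text \<open>(A1)-(A3) at one frozen point \<open>x\<close>. All pointwise estimates are proved here
  and interpreted under the integral sign; \<open>m\<close> and \<open>M\<close> are the same for
  every \<open>x\<close>.\<close>

locale viscosity_profile =
  fixes \<nu> \<nu>' :: "real \<Rightarrow> real" and m M :: real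
  assumes has_deriv: "0 \<le> t \<Longrightarrow> (\<nu> has_real_derivative \<nu>' t) (at t within {0..})"
    and deriv_continuous: "continuous_on {0..} \<nu>'"
    and deriv_nonpos: "0 \<le> t \<Longrightarrow> \<nu>' t \<le> 0"
    and m_pos: "0 < m"
    and flux_lower: "\<lbrakk>0 \<le> s; s \<le> t\<rbrakk> \<Longrightarrow> m * (t - s) \<le> \<nu> (t\<^sup>2) * t - \<nu> (s\<^sup>2) * s"
    and flux_upper: "\<lbrakk>0 \<le> s; s \<le> t\<rbrakk> \<Longrightarrow> \<nu> (t\<^sup>2) * t - \<nu> (s\<^sup>2) * s \<le> M * (t - s)"
begin

section \<open>Calculus after the substitution of \<open>t^2\<close> for the argument\<close>

lemma continuous: "continuous_on {0..} \<nu>"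
  by (auto simp: continuous_on_eq_continuous_within intro: DERIV_continuous has_deriv)

text \<open>Squares stay in the half-line, so a derivative within it suffices for the chain rule,
  and the composite is two-sidedly differentiable even at 0.\<close>

lemma DERIV_square_comp:
  assumes "(g has_real_derivative D) (at (t\<^sup>2) within {0..})"
  shows "((\<lambda>t. g (t\<^sup>2)) has_real_derivative D * (2 * t)) (at t)"
proof -
  have "(g has_real_derivative D) (at (t\<^sup>2) within range (\<lambda>t. t\<^sup>2))"
    by (rule has_field_derivative_subset[OF assms]) auto
  moreover have "((\<lambda>t. t\<^sup>2) has_real_derivative 2 * t) (at t)"
    by (auto intro!: derivative_eq_intros)
  ultimately have "(g \<circ> (\<lambda>t. t\<^sup>2) has_real_derivative D * (2 * t)) (at t)"
    by (rule DERIV_image_chain)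
  then show ?thesis by (simp add: o_def)
qed

lemma DERIV_visc_square: "((\<lambda>t. \<nu> (t\<^sup>2)) has_real_derivative \<nu>' (t\<^sup>2) * (2 * t)) (at t)"
  by (rule DERIV_square_comp) (simp add: has_deriv)

lemma DERIV_flux: "((\<lambda>t. \<nu> (t\<^sup>2) * t) has_real_derivative flux_deriv \<nu> \<nu>' t) (at t)"
  by (rule derivative_eq_intros DERIV_visc_square refl)+
     (simp add: flux_deriv_def power2_eq_square)

lemma DERIV_potential_square: "((\<lambda>t. potential \<nu> (t\<^sup>2)) has_real_derivative \<nu> (t\<^sup>2) * t) (at t)"
proof -
  define s where "s = t\<^sup>2"
  have s: "0 \<le> s" by (simp add: s_def)
  have "((\<lambda>x. integral {0..x} \<nu>) has_real_derivative \<nu> s) (at s within {0..s+1})"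
    using s by (intro integral_has_real_derivative continuous_on_subset[OF continuous]) auto
  \<comment> \<open>The end point \<open>s+1\<close> leaves room to the right of \<open>s\<close>,
    so the compact interval and the half-line agree near \<open>s\<close>.\<close>
  moreover have "at s within {0..s+1} = at s within {0..}"
    by (rule at_within_nhd[of _ "{..<s+1}"]) auto
  ultimately have "(potential \<nu> has_real_derivative (1/2) * \<nu> s) (at s within {0..})"
    unfolding potential_def by (intro DERIV_cmult) auto
  from DERIV_square_comp[OF this[unfolded s_def]] show ?thesis by simp
qed

text \<open>(A2) bounds the difference quotients of the flux, and the bounds survive the limit.
  Quotients from the right are used because \<open>t = 0\<close> is allowed.\<close>

lemma flux_deriv_bounds:
  assumes "0 \<le> t"
  shows "m \<le> flux_deriv \<nu> \<nu>' t" "flux_deriv \<nu> \<nu>' t \<le> M"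
proof -
  let ?q = "\<lambda>y. (\<nu> (y\<^sup>2) * y - \<nu> (t\<^sup>2) * t) / (y - t)"
  have "(?q \<longlongrightarrow> flux_deriv \<nu> \<nu>' t) (at t)"
    using DERIV_flux[of t] by (simp add: has_field_derivative_iff)
  then have lim: "(?q \<longlongrightarrow> flux_deriv \<nu> \<nu>' t) (at_right t)"
    by (simp add: filterlim_at_split)
  have "\<forall>\<^sub>F y in at_right t. m \<le> ?q y" "\<forall>\<^sub>F y in at_right t. ?q y \<le> M"
    using assms flux_lower[of t] flux_upper[of t]
    by (auto simp: eventually_at_filter field_simps)
  then show "m \<le> flux_deriv \<nu> \<nu>' t" "flux_deriv \<nu> \<nu>' t \<le> M"
    using tendsto_lowerbound[OF lim] tendsto_upperbound[OF lim] by auto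
qed

lemma flux_deriv_le: "flux_deriv \<nu> \<nu>' t \<le> \<nu> (t\<^sup>2)"
  using deriv_nonpos[of "t\<^sup>2"] by (simp add: flux_deriv_def mult_nonpos_nonneg)

lemma visc_lower: "m \<le> \<nu> (t\<^sup>2)"
  using flux_deriv_le[of "\<bar>t\<bar>"] flux_deriv_bounds(1)[of "\<bar>t\<bar>"] by simp

text \<open>For nonzero \<open>t\<close> this is (A2) with \<open>s = 0\<close>, divided by
  \<open>t\<close>; at 0 the flux derivative coincides with the viscosity.\<close>

lemma visc_upper: "\<nu> (t\<^sup>2) \<le> M"
proof (cases "t = 0")
  case True
  then show ?thesis using flux_deriv_bounds(2)[of 0] by (simp add: flux_deriv_def)
next
  case False
  then show ?thesis using flux_upper[of 0 "\<bar>t\<bar>"] by simp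
qed

lemma visc_antimono:
  assumes "0 \<le> s" "s \<le> t"
  shows "\<nu> (t\<^sup>2) \<le> \<nu> (s\<^sup>2)"
proof (rule DERIV_nonpos_imp_nonincreasing[OF assms(2)])
  fix x assume "s \<le> x" "x \<le> t"
  then show "\<exists>y. ((\<lambda>t. \<nu> (t\<^sup>2)) has_real_derivative y) (at x) \<and> y \<le> 0"
    using assms DERIV_visc_square[of x] deriv_nonpos[of "x\<^sup>2"]
    by (intro exI[of _ "\<nu>' (x\<^sup>2) * (2 * x)"]) (auto simp: mult_nonpos_nonneg)
qed

lemma isCont_flux_deriv:
  "isCont (flux_deriv \<nu> \<nu>') t"
proof -
  have "continuous_on UNIV (\<lambda>t. \<nu>' (t\<^sup>2))"
    by (rule continuous_on_compose2[OF deriv_continuous]) (auto intro!: continuous_intros)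
  moreover have "continuous_on UNIV (\<lambda>t. \<nu> (t\<^sup>2))"
    by (rule continuous_on_compose2[OF continuous]) (auto intro!: continuous_intros)
  ultimately have "continuous_on UNIV (flux_deriv \<nu> \<nu>')"
    unfolding flux_deriv_def[abs_def] by (intro continuous_intros)
  then show ?thesis by (simp add: continuous_on_eq_continuous_at)
qed

text \<open>A decreasing viscosity makes the potential concave in \<open>s = t^2\<close>, so it lies
  below its tangent. The difference \<open>D\<close> therefore has its maximum at \<open>a\<close>.
  This is what makes the Kacanov quadratic a majorant of the energy.\<close>

lemma potential_le_tangent:
  assumes "0 \<le> a" "0 \<le> b"
  shows "potential \<nu> (b\<^sup>2) - potential \<nu> (a\<^sup>2) \<le> (1/2) * \<nu> (a\<^sup>2) * (b\<^sup>2 - a\<^sup>2)"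
proof -
  define D where "D t = potential \<nu> (t\<^sup>2) - (1/2) * \<nu> (a\<^sup>2) * t\<^sup>2" for t
  have D: "(D has_real_derivative (\<nu> (t\<^sup>2) - \<nu> (a\<^sup>2)) * t) (at t)" for t
    unfolding D_def[abs_def]
    by (rule derivative_eq_intros DERIV_potential_square refl)+ (simp add: algebra_simps)
  have "D b \<le> D a"
  proof (cases "a \<le> b")
    case True
    then show ?thesis
    proof (rule DERIV_nonpos_imp_nonincreasing)
      fix x assume "a \<le> x" "x \<le> b"
      then show "\<exists>y. (D has_real_derivative y) (at x) \<and> y \<le> 0"
        using assms D[of x] visc_antimono[of a x]
        by (intro exI[of _ "(\<nu> (x\<^sup>2) - \<nu> (a\<^sup>2)) * x"]) (auto simp: mult_nonpos_nonneg)
    qed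
  next
    case False
    then have "b \<le> a" by simp
    then show ?thesis
    proof (rule DERIV_nonneg_imp_nondecreasing)
      fix x assume "b \<le> x" "x \<le> a"
      then show "\<exists>y. (D has_real_derivative y) (at x) \<and> y \<ge> 0"
        using assms D[of x] visc_antimono[of x a]
        by (intro exI[of _ "(\<nu> (x\<^sup>2) - \<nu> (a\<^sup>2)) * x"]) auto
    qed
  qed
  then show ?thesis by (simp add: D_def algebra_simps)
qed

section \<open>Two-sided bounds on the Bregman divergence\<close>

lemma potential_Taylor:
  obtains \<xi> where "min a b \<le> \<xi>" "\<xi> \<le> max a b"
    "potential \<nu> (b\<^sup>2) - potential \<nu> (a\<^sup>2) - \<nu> (a\<^sup>2) * a * (b - a) = (1/2) * flux_deriv \<nu> \<nu>' \<xi> * (b - a)\<^sup>2"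
proof (cases "a = b")
  case True
  then show ?thesis using that[of a] by simp
next
  case False
  define d where "d k = (if k = 0 then (\<lambda>t. potential \<nu> (t\<^sup>2)) else
    if k = 1 then (\<lambda>t. \<nu> (t\<^sup>2) * t) else flux_deriv \<nu> \<nu>')" for k :: nat
  have "\<forall>k t. k < 2 \<and> min a b \<le> t \<and> t \<le> max a b \<longrightarrow> DERIV (d k) t :> d (Suc k) t"
    by (auto simp: d_def less_2_cases_iff DERIV_flux DERIV_potential_square)
  then have "\<exists>t. (if b < a then b < t \<and> t < a else a < t \<and> t < b) \<and>
      potential \<nu> (b\<^sup>2) = (\<Sum>k<2. (d k a / fact k) * (b - a)^k) + (d 2 t / fact 2) * (b - a)^2"
    using False by (intro Taylor[where a = "min a b" and b = "max a b"]) (auto simp: d_def)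
  then obtain t where "if b < a then b < t \<and> t < a else a < t \<and> t < b"
      "potential \<nu> (b\<^sup>2) = (\<Sum>k<2. (d k a / fact k) * (b - a)^k) + (d 2 t / fact 2) * (b - a)^2"
    by blast
  then show ?thesis
    using False by (intro that[of t]) (auto simp: d_def numeral_2_eq_2 split: if_splits)
qed

text \<open>Both the divergence and \<open>(norm (B - A))^2\<close> split into a radial part in
  \<open>(b - a)^2\<close> and an angular part in \<open>a * b - A \<bullet> B\<close>, which is
  nonnegative by Cauchy-Schwarz. The radial coefficient is a flux derivative between the two norms;
  the angular one is the viscosity at \<open>a\<close>, which dominates the flux derivative there.
  The free \<open>c\<close> serves both for the global bound \<open>m\<close> and for a local bound
  near \<open>A\<close>.\<close>

lemma bregman_ge:
  assumes "\<And>t. \<lbrakk>min (norm A) (norm B) \<le> t; t \<le> max (norm A) (norm B)\<rbrakk> \<Longrightarrow> c \<le> flux_deriv \<nu> \<nu>' t"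
  shows "(1/2) * c * (norm (B - A))\<^sup>2 \<le> bregman \<nu> A B"
proof -
  define a b where "a = norm A" and "b = norm B"
  obtain \<xi> where \<xi>: "min a b \<le> \<xi>" "\<xi> \<le> max a b"
    "potential \<nu> (b\<^sup>2) - potential \<nu> (a\<^sup>2) - \<nu> (a\<^sup>2) * a * (b - a) = (1/2) * flux_deriv \<nu> \<nu>' \<xi> * (b - a)\<^sup>2"
    by (rule potential_Taylor)
  have "A \<bullet> (B - A) = A \<bullet> B - a\<^sup>2"
    by (simp add: a_def inner_diff_right power2_norm_eq_inner)
  then have "bregman \<nu> A B = potential \<nu> (b\<^sup>2) - potential \<nu> (a\<^sup>2) - \<nu> (a\<^sup>2) * (A \<bullet> B - a\<^sup>2)"
    by (simp add: bregman_def a_def b_def)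
  also have "\<dots> = potential \<nu> (b\<^sup>2) - potential \<nu> (a\<^sup>2) - \<nu> (a\<^sup>2) * a * (b - a) + \<nu> (a\<^sup>2) * (a * b - A \<bullet> B)"
    by (simp add: algebra_simps power2_eq_square)
  finally have eq: "bregman \<nu> A B = (1/2) * flux_deriv \<nu> \<nu>' \<xi> * (b - a)\<^sup>2 + \<nu> (a\<^sup>2) * (a * b - A \<bullet> B)"
    by (simp only: \<xi>(3))
  have "(norm (B - A))\<^sup>2 = (b - a)\<^sup>2 + 2 * (a * b - A \<bullet> B)"
    by (simp add: a_def b_def power2_norm_eq_inner inner_diff_left inner_diff_right inner_commute
      power2_diff)
  then have "(1/2) * c * (norm (B - A))\<^sup>2 = (1/2) * c * (b - a)\<^sup>2 + c * (a * b - A \<bullet> B)"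
    by (simp add: distrib_left)
  also have "\<dots> \<le> bregman \<nu> A B"
    unfolding eq
  proof (intro add_mono)
    show "(1/2) * c * (b - a)\<^sup>2 \<le> (1/2) * flux_deriv \<nu> \<nu>' \<xi> * (b - a)\<^sup>2"
      using assms[of \<xi>] \<xi>(1,2) by (intro mult_right_mono) (auto simp: a_def b_def)
    show "c * (a * b - A \<bullet> B) \<le> \<nu> (a\<^sup>2) * (a * b - A \<bullet> B)"
      using assms[of a] flux_deriv_le[of a] norm_cauchy_schwarz[of A B]
      by (intro mult_right_mono) (auto simp: a_def b_def)
  qed
  finally show ?thesis .
qed

lemma bregman_lower: "(1/2) * m * (norm (B - A))\<^sup>2 \<le> bregman \<nu> A B"
  by (rule bregman_ge) (metis flux_deriv_bounds(1) min_def norm_ge_zero order_trans)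

text \<open>Concavity in the squared norm: the linear part of \<open>(norm B)^2 - (norm A)^2\<close>
  is the term subtracted in \<open>bregman\<close>, and only the square of \<open>B - A\<close> is
  left.\<close>

lemma bregman_le_quadratic: "bregman \<nu> A B \<le> (1/2) * \<nu> ((norm A)\<^sup>2) * (norm (B - A))\<^sup>2"
proof -
  have eq: "(norm B)\<^sup>2 - (norm A)\<^sup>2 = 2 * (A \<bullet> (B - A)) + (norm (B - A))\<^sup>2"
    by (simp add: power2_norm_eq_inner inner_diff_left inner_diff_right inner_commute)
  have "potential \<nu> ((norm B)\<^sup>2) - potential \<nu> ((norm A)\<^sup>2)
      \<le> (1/2) * \<nu> ((norm A)\<^sup>2) * (2 * (A \<bullet> (B - A)) + (norm (B - A))\<^sup>2)"
    using potential_le_tangent[of "norm A" "norm B"] by (simp only: eq norm_ge_zero)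
  then show ?thesis by (simp add: bregman_def distrib_left mult.assoc)
qed

lemma bregman_upper: "bregman \<nu> A B \<le> (1/2) * M * (norm (B - A))\<^sup>2"
  by (rule order_trans[OF bregman_le_quadratic]) (intro mult_right_mono mult_left_mono visc_upper, auto)

lemma potential_bounds:
  assumes "0 \<le> s"
  shows "0 \<le> potential \<nu> s" "potential \<nu> s \<le> (1/2) * M * s"
proof -
  \<comment> \<open>The potential is the divergence from the origin, here on the real line, so the
    bounds for \<open>bregman\<close> carry over.\<close>
  have "bregman \<nu> 0 (sqrt s) = potential \<nu> s" using assms by (simp add: bregman_def potential_def)
  moreover have "0 \<le> m * s" using assms m_pos by simp
  ultimately show "0 \<le> potential \<nu> s" "potential \<nu> s \<le> (1/2) * M * s"
    using bregman_lower[of "sqrt s" 0] bregman_upper[of 0 "sqrt s"] assms by auto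
qed

lemma bregman_defect_le: "bregman_defect \<nu> \<nu>' A B \<le> (1/2) * M * (norm (B - A))\<^sup>2"
proof -
  have "(1/2) * flux_deriv \<nu> \<nu>' (norm B) * (norm (B - A))\<^sup>2 \<le> (1/2) * M * (norm (B - A))\<^sup>2"
    using flux_deriv_bounds(2)[of "norm B"] by (intro mult_right_mono) auto
  moreover have "0 \<le> bregman \<nu> A B" 
    using m_pos by (intro order_trans[OF _ bregman_lower]) auto
  moreover have "0 \<le> M" using m_pos flux_deriv_bounds[of 0] by simp
  moreover have "0 \<le> (1/2) * M * (norm (B - A))\<^sup>2" using \<open>0 \<le> M\<close> by simp
  ultimately show ?thesis unfolding bregman_defect_def by (intro max.boundedI) linarith+
qed

text \<open>Continuity of the flux derivative at \<open>norm A\<close> makes it nearly constant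
  between the two norms. The radius depends on the profile and on \<open>A\<close>; uniformity in
  \<open>x\<close> is recovered later by dominated convergence.\<close>

lemma bregman_defect_small:
  assumes "0 < \<epsilon>"
  obtains \<delta> where "0 < \<delta>" "\<And>B. norm (B - A) < \<delta> \<Longrightarrow> bregman_defect \<nu> \<nu>' A B \<le> \<epsilon> * (norm (B - A))\<^sup>2"
proof -
  obtain \<delta> where \<delta>: "0 < \<delta>" "\<And>t. \<bar>t - norm A\<bar> < \<delta> \<Longrightarrow> \<bar>flux_deriv \<nu> \<nu>' t - flux_deriv \<nu> \<nu>' (norm A)\<bar> < \<epsilon>"
    using isCont_flux_deriv[of "norm A"] assms
    unfolding continuous_at_eps_delta dist_real_def by metis
  show ?thesis
  proof (rule that[OF \<delta>(1)])
    fix B assume "norm (B - A) < \<delta>"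
    then have ab: "\<bar>norm B - norm A\<bar> < \<delta>"
      using norm_triangle_ineq3[of B A] by linarith
    \<comment> \<open>Any \<open>t\<close> between the norms and \<open>norm B\<close> itself each
      cost one \<epsilon> of deviation from the value at \<open>norm A\<close>, hence the factor 2;
      the leading 1/2 turns it back into \<epsilon>.\<close>
    have "(1/2) * (flux_deriv \<nu> \<nu>' (norm B) - 2 * \<epsilon>) * (norm (B - A))\<^sup>2 \<le> bregman \<nu> A B"
    proof (rule bregman_ge)
      fix t assume "min (norm A) (norm B) \<le> t" "t \<le> max (norm A) (norm B)"
      then have "\<bar>t - norm A\<bar> < \<delta>" using ab by linarith
      from \<delta>(2)[OF this] \<delta>(2)[OF ab] show "flux_deriv \<nu> \<nu>' (norm B) - 2 * \<epsilon> \<le> flux_deriv \<nu> \<nu>' t"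
        by linarith
    qed
    then show "bregman_defect \<nu> \<nu>' A B \<le> \<epsilon> * (norm (B - A))\<^sup>2"
      using assms by (auto simp: bregman_defect_def algebra_simps)
  qed
qed

end

section \<open>The space of square-integrable fields\<close>

text \<open>Used for Cauchy-Schwarz and, with \<open>a = 0\<close>, for the first-order condition at
  the minimiser.\<close>

lemma quadratic_nonneg_imp_discriminant:
  fixes a b c :: real
  assumes "\<And>t. 0 \<le> a - 2 * t * b + t\<^sup>2 * c"
  shows "b\<^sup>2 \<le> a * c"
proof (cases "c = 0")
  case True
  have "b = 0"
  proof (rule ccontr)
    assume "b \<noteq> 0"
    \<comment> \<open>With \<open>c = 0\<close> this choice of \<open>t\<close> gives the polynomial
      the value -1.\<close>
    then show False using assms[of "(a + 1) / (2 * b)"] True by simp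
  qed
  then show ?thesis using True by simp
next
  case False
  have "c \<ge> 0"
  proof (rule ccontr)
    assume "\<not> c \<ge> 0"
    then have c: "c < 0" by simp
    \<comment> \<open>Chosen so that \<open>c * t\<close> absorbs both \<open>a\<close> and the
      linear coefficient; the polynomial is then at most \<open>c\<close>, which is
      negative.\<close>
    define t where "t = 1 + (\<bar>a\<bar> + 2 * \<bar>b\<bar>) / (- c)"
    have "1 \<le> t" using c by (simp add: t_def divide_nonneg_neg divide_nonneg_pos del: divide_minus_right)
    have ct: "c * t = c - (\<bar>a\<bar> + 2 * \<bar>b\<bar>)" using c by (simp add: t_def field_simps)
    have "a - 2 * t * b + t\<^sup>2 * c = a + t * (- 2 * b + c * t)"
      by (simp add: power2_eq_square algebra_simps)
    also have "\<dots> \<le> a + t * (c - \<bar>a\<bar>)"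
      unfolding ct using \<open>1 \<le> t\<close> by (intro add_left_mono mult_left_mono) auto
    also have "t * (c - \<bar>a\<bar>) \<le> 1 * (c - \<bar>a\<bar>)"
      using \<open>1 \<le> t\<close> c by (intro mult_right_mono_neg) auto
    finally show False using assms[of t] c by simp
  qed
  then have "c > 0" using False by simp
  then show ?thesis using assms[of "b / c"] by (simp add: field_simps power2_eq_square)
qed

definition L2_inner :: "(real^'d) set \<Rightarrow> (real^'d \<Rightarrow> 'b::euclidean_space) \<Rightarrow> (real^'d \<Rightarrow> 'b) \<Rightarrow> real"
  where "L2_inner \<Omega> g h = (LINT x|lebesgue_on \<Omega>. g x \<bullet> h x)"

section \<open>Square-integrable fields as a semi-inner product space, definite up to null
  sets\<close>

lemma L2_measurable: "g \<in> L2 \<Omega> \<Longrightarrow> g \<in> borel_measurable (lebesgue_on \<Omega>)"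
  by (simp add: L2_def)

lemma L2_dominated:
  assumes g: "g \<in> L2 \<Omega>" and h: "h \<in> borel_measurable (lebesgue_on \<Omega>)"
    and le: "AE x in lebesgue_on \<Omega>. norm (h x) \<le> c * norm (g x)"
  shows "h \<in> L2 \<Omega>"
proof -
  have "integrable (lebesgue_on \<Omega>) (\<lambda>x. c\<^sup>2 * (norm (g x))\<^sup>2)"
    using g by (simp add: L2_def)
  then have "integrable (lebesgue_on \<Omega>) (\<lambda>x. (norm (h x))\<^sup>2)"
    by (rule Bochner_Integration.integrable_bound)
       (use h le in \<open>auto elim!: eventually_mono intro: power_mono simp flip: power_mult_distrib\<close>)
  with h show ?thesis by (simp add: L2_def)
qed

lemma L2_scaleR: "g \<in> L2 \<Omega> \<Longrightarrow> (\<lambda>x. c *\<^sub>R g x) \<in> L2 \<Omega>"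
  by (rule L2_dominated[where c = "\<bar>c\<bar>"]) (auto intro: borel_measurable_scaleR dest: L2_measurable)

lemma L2_add:
  assumes "g \<in> L2 \<Omega>" "h \<in> L2 \<Omega>"
  shows "(\<lambda>x. g x + h x) \<in> L2 \<Omega>"
proof -
  have "integrable (lebesgue_on \<Omega>) (\<lambda>x. 2 * ((norm (g x))\<^sup>2 + (norm (h x))\<^sup>2))"
    using assms by (simp add: L2_def)
  moreover have "(norm (g x + h x))\<^sup>2 \<le> 2 * ((norm (g x))\<^sup>2 + (norm (h x))\<^sup>2)" for x
  proof -
    have "(norm (g x + h x))\<^sup>2 \<le> (norm (g x) + norm (h x))\<^sup>2"
      by (intro power_mono norm_triangle_ineq) simp
    also have "\<dots> \<le> 2 * ((norm (g x))\<^sup>2 + (norm (h x))\<^sup>2)"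
      using sum_squares_bound[of "norm (g x)" "norm (h x)"] by (simp add: power2_sum)
    finally show ?thesis .
  qed
  moreover have [measurable]: "g \<in> borel_measurable (lebesgue_on \<Omega>)" "h \<in> borel_measurable (lebesgue_on \<Omega>)"
    using assms by (auto dest: L2_measurable)
  ultimately have "integrable (lebesgue_on \<Omega>) (\<lambda>x. (norm (g x + h x))\<^sup>2)"
    by (auto intro: Bochner_Integration.integrable_bound)
  with assms show ?thesis by (simp add: L2_def)
qed

lemma L2_diff: "g \<in> L2 \<Omega> \<Longrightarrow> h \<in> L2 \<Omega> \<Longrightarrow> (\<lambda>x. g x - h x) \<in> L2 \<Omega>"
  using L2_add[OF _ L2_scaleR[of h \<Omega> "-1"], of g] by simp

lemma L2_zero: "(\<lambda>x. 0) \<in> L2 \<Omega>"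
  by (simp add: L2_def)

lemma L2_sum: "(\<And>i. i \<in> I \<Longrightarrow> g i \<in> L2 \<Omega>) \<Longrightarrow> (\<lambda>x. \<Sum>i\<in>I. g i x) \<in> L2 \<Omega>"
  by (induction I rule: infinite_finite_induct) (auto simp: L2_zero L2_add)

lemma L2_norm: "g \<in> L2 \<Omega> \<Longrightarrow> (\<lambda>x. norm (g x)) \<in> L2 \<Omega>"
  by (auto simp: L2_def intro: borel_measurable_norm)

lemma L2_inner_integrable:
  assumes "g \<in> L2 \<Omega>" "h \<in> L2 \<Omega>"
  shows "integrable (lebesgue_on \<Omega>) (\<lambda>x. g x \<bullet> h x)"
proof (rule Bochner_Integration.integrable_bound)
  show "integrable (lebesgue_on \<Omega>) (\<lambda>x. (norm (g x))\<^sup>2 + (norm (h x))\<^sup>2)"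
    using assms by (simp add: L2_def)
  show "(\<lambda>x. g x \<bullet> h x) \<in> borel_measurable (lebesgue_on \<Omega>)"
    using assms by (intro borel_measurable_inner L2_measurable)
  have "\<bar>g x \<bullet> h x\<bar> \<le> (norm (g x))\<^sup>2 + (norm (h x))\<^sup>2" for x
    using Cauchy_Schwarz_ineq2[of "g x" "h x"] sum_squares_bound[of "norm (g x)" "norm (h x)"]
      mult_nonneg_nonneg[of "norm (g x)" "norm (h x)"] by simp
  then show "AE x in lebesgue_on \<Omega>. norm (g x \<bullet> h x) \<le> norm ((norm (g x))\<^sup>2 + (norm (h x))\<^sup>2)"
    by auto
qed

lemma L2_inner_commute: "L2_inner \<Omega> g h = L2_inner \<Omega> h g"
  by (simp add: L2_inner_def inner_commute)

lemma L2_inner_self: "L2_inner \<Omega> g g = (LINT x|lebesgue_on \<Omega>. (norm (g x))\<^sup>2)"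
  by (simp add: L2_inner_def power2_norm_eq_inner)

lemma L2_inner_self_nonneg: "0 \<le> L2_inner \<Omega> g g"
  by (simp add: L2_inner_self)

lemma L2_inner_cong_AE:
  assumes "g \<in> L2 \<Omega>" "g' \<in> L2 \<Omega>" "h \<in> L2 \<Omega>" "h' \<in> L2 \<Omega>"
    and "AE x in lebesgue_on \<Omega>. g x = g' x" "AE x in lebesgue_on \<Omega>. h x = h' x"
  shows "L2_inner \<Omega> g h = L2_inner \<Omega> g' h'"
  unfolding L2_inner_def using assms
  by (intro integral_cong_AE borel_measurable_inner L2_measurable) auto

lemma L2_inner_add_left:
  "\<lbrakk>g \<in> L2 \<Omega>; g' \<in> L2 \<Omega>; h \<in> L2 \<Omega>\<rbrakk> \<Longrightarrow>
    L2_inner \<Omega> (\<lambda>x. g x + g' x) h = L2_inner \<Omega> g h + L2_inner \<Omega> g' h"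
  by (simp add: L2_inner_def inner_add_left L2_inner_integrable)

lemma L2_inner_diff_left:
  "\<lbrakk>g \<in> L2 \<Omega>; g' \<in> L2 \<Omega>; h \<in> L2 \<Omega>\<rbrakk> \<Longrightarrow>
    L2_inner \<Omega> (\<lambda>x. g x - g' x) h = L2_inner \<Omega> g h - L2_inner \<Omega> g' h"
  by (simp add: L2_inner_def inner_diff_left L2_inner_integrable)

lemma L2_inner_diff_right:
  "\<lbrakk>g \<in> L2 \<Omega>; g' \<in> L2 \<Omega>; h \<in> L2 \<Omega>\<rbrakk> \<Longrightarrow>
    L2_inner \<Omega> h (\<lambda>x. g x - g' x) = L2_inner \<Omega> h g - L2_inner \<Omega> h g'"
  by (simp add: L2_inner_def inner_diff_right L2_inner_integrable)

lemma L2_inner_scaleR_left: "L2_inner \<Omega> (\<lambda>x. c *\<^sub>R g x) h = c * L2_inner \<Omega> g h"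
  by (simp add: L2_inner_def)

lemma L2_inner_scaleR_right: "L2_inner \<Omega> h (\<lambda>x. c *\<^sub>R g x) = c * L2_inner \<Omega> h g"
  by (simp add: L2_inner_def)

lemma L2_inner_sum_left:
  assumes "\<And>i. i \<in> I \<Longrightarrow> g i \<in> L2 \<Omega>" "h \<in> L2 \<Omega>"
  shows "L2_inner \<Omega> (\<lambda>x. \<Sum>i\<in>I. g i x) h = (\<Sum>i\<in>I. L2_inner \<Omega> (g i) h)"
  using assms unfolding L2_inner_def inner_sum_left
  by (intro Bochner_Integration.integral_sum L2_inner_integrable)

lemma L2_inner_self_eq_0D:
  assumes "g \<in> L2 \<Omega>" "L2_inner \<Omega> g g = 0"
  shows "AE x in lebesgue_on \<Omega>. g x = 0"
proof -
  have "integrable (lebesgue_on \<Omega>) (\<lambda>x. (norm (g x))\<^sup>2)" using assms by (simp add: L2_def)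
  then show ?thesis
    using integral_nonneg_eq_0_iff_AE[of "lebesgue_on \<Omega>" "\<lambda>x. (norm (g x))\<^sup>2"] assms(2)
    by (simp add: L2_inner_self)
qed

text \<open>The squared norm of \<open>g - t h\<close> is a nonnegative quadratic polynomial in
  \<open>t\<close>.\<close>

lemma L2_Cauchy_Schwarz:
  assumes "g \<in> L2 \<Omega>" "h \<in> L2 \<Omega>"
  shows "(L2_inner \<Omega> g h)\<^sup>2 \<le> L2_inner \<Omega> g g * L2_inner \<Omega> h h"
proof (rule quadratic_nonneg_imp_discriminant)
  fix t :: real
  have "0 \<le> L2_inner \<Omega> (\<lambda>x. g x - t *\<^sub>R h x) (\<lambda>x. g x - t *\<^sub>R h x)"
    by (rule L2_inner_self_nonneg)
  also have "\<dots> = L2_inner \<Omega> g g - 2 * t * L2_inner \<Omega> g h + t\<^sup>2 * L2_inner \<Omega> h h"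
    using assms L2_inner_commute[of \<Omega> h g]
    by (simp add: L2_inner_diff_left L2_inner_diff_right L2_diff L2_scaleR L2_inner_scaleR_left
      L2_inner_scaleR_right algebra_simps power2_eq_square)
  finally show "0 \<le> L2_inner \<Omega> g g - 2 * t * L2_inner \<Omega> g h + t\<^sup>2 * L2_inner \<Omega> h h" .
qed

text \<open>Gram-Schmidt by induction on \<open>B\<close>. A residual of norm zero means that the
  new field already lies in the span almost everywhere; otherwise the normalised residual extends
  the system.\<close>

lemma L2_orthonormal_system:
  fixes g :: "'b \<Rightarrow> real^'d \<Rightarrow> 'e::euclidean_space"
  assumes "finite B" "\<forall>b\<in>B. g b \<in> L2 \<Omega>"
  shows "\<exists>(k::nat) e. (\<forall>i<k. e i \<in> L2 \<Omega>) \<and>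
    (\<forall>i<k. \<forall>j<k. L2_inner \<Omega> (e i) (e j) = (if i = j then 1 else 0)) \<and>
    (\<forall>b\<in>B. \<exists>d. AE x in lebesgue_on \<Omega>. g b x = (\<Sum>i<k. d i *\<^sub>R e i x))"
  using assms
proof (induction B)
  case empty
  show ?case by (intro exI[of _ "0::nat"] exI[of _ "\<lambda>_ _. 0"]) simp
next
  case (insert b B)
  then obtain k :: nat and e where e: "\<And>i. i < k \<Longrightarrow> e i \<in> L2 \<Omega>"
    and orth: "\<And>i j. i < k \<Longrightarrow> j < k \<Longrightarrow> L2_inner \<Omega> (e i) (e j) = (if i = j then 1 else 0)"
    and span: "\<And>b. b \<in> B \<Longrightarrow> \<exists>d. AE x in lebesgue_on \<Omega>. g b x = (\<Sum>i<k. d i *\<^sub>R e i x)"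
  proof -
    from insert.IH insert.prems obtain k :: nat and e where "(\<forall>i<k. e i \<in> L2 \<Omega>) \<and>
      (\<forall>i<k. \<forall>j<k. L2_inner \<Omega> (e i) (e j) = (if i = j then 1 else 0)) \<and>
      (\<forall>b\<in>B. \<exists>d. AE x in lebesgue_on \<Omega>. g b x = (\<Sum>i<k. d i *\<^sub>R e i x))"
      by blast
    then show ?thesis by (intro that[of k e]) blast+
  qed
  have gb: "g b \<in> L2 \<Omega>" using insert.prems by simp
  define d where "d i = L2_inner \<Omega> (g b) (e i)" for i
  define r where "r x = g b x - (\<Sum>i<k. d i *\<^sub>R e i x)" for x
  have sm: "(\<lambda>x. \<Sum>i<k. d i *\<^sub>R e i x) \<in> L2 \<Omega>" using e by (intro L2_sum L2_scaleR) auto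
  have r: "r \<in> L2 \<Omega>" unfolding r_def[abs_def] by (intro L2_diff gb sm)
  have r_orth: "L2_inner \<Omega> r (e j) = 0" if "j < k" for j
  proof -
    have "L2_inner \<Omega> r (e j) = d j - L2_inner \<Omega> (\<lambda>x. \<Sum>i<k. d i *\<^sub>R e i x) (e j)"
      unfolding r_def[abs_def] d_def using L2_inner_diff_left[OF gb sm e[OF that]] by (simp add: d_def)
    also have "L2_inner \<Omega> (\<lambda>x. \<Sum>i<k. d i *\<^sub>R e i x) (e j) = (\<Sum>i<k. d i * L2_inner \<Omega> (e i) (e j))"
      using e that by (subst L2_inner_sum_left) (auto simp: L2_scaleR L2_inner_scaleR_left)
    also have "\<dots> = (\<Sum>i<k. if i = j then d i else 0)"
      using that by (intro sum.cong) (auto simp: orth)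
    also have "\<dots> = d j" using that by simp
    finally show ?thesis by simp
  qed
  show ?case
  proof (cases "L2_inner \<Omega> r r = 0")
    case True
    then have "AE x in lebesgue_on \<Omega>. g b x = (\<Sum>i<k. d i *\<^sub>R e i x)"
      using L2_inner_self_eq_0D[OF r] by (simp add: r_def)
    then have "\<forall>b\<in>insert b B. \<exists>d. AE x in lebesgue_on \<Omega>. g b x = (\<Sum>i<k. d i *\<^sub>R e i x)"
      using span by blast
    then show ?thesis using e orth by blast
  next
    case False
    define s where "s = sqrt (L2_inner \<Omega> r r)"
    have s: "s \<noteq> 0" "s * s = L2_inner \<Omega> r r" using False L2_inner_self_nonneg[of \<Omega> r] by (auto simp: s_def)
    define e' where "e' = e(k := (\<lambda>x. (1/s) *\<^sub>R r x))"
    have e'_old: "e' i = e i" if "i < k" for i using that by (simp add: e'_def)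
    have e'_new: "e' k = (\<lambda>x. (1/s) *\<^sub>R r x)" by (simp add: e'_def)
    have ext: "(\<Sum>i<Suc k. (c(k := t)) i *\<^sub>R e' i x) = (\<Sum>i<k. c i *\<^sub>R e i x) + (t/s) *\<^sub>R r x" for c t x
      by (simp add: e'_old e'_new)
    show ?thesis
    proof (intro exI[of _ "Suc k"] exI[of _ e'] conjI ballI allI impI)
      show "e' i \<in> L2 \<Omega>" if "i < Suc k" for i
        using that e r by (cases "i = k") (auto simp: e'_old e'_new L2_scaleR)
      show "L2_inner \<Omega> (e' i) (e' j) = (if i = j then 1 else 0)" if "i < Suc k" "j < Suc k" for i j
        using that orth r_orth s L2_inner_commute[of \<Omega> r "e i"]
        by (cases "i = k"; cases "j = k")
           (auto simp: e'_old e'_new L2_inner_scaleR_left L2_inner_scaleR_right field_simps)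
      show "\<exists>d. AE x in lebesgue_on \<Omega>. g b' x = (\<Sum>i<Suc k. d i *\<^sub>R e' i x)" if b': "b' \<in> insert b B" for b'
      proof (cases "b' = b")
        case True
        \<comment> \<open>The residual is \<open>s\<close> times the new unit field, so
          \<open>s\<close> is its coefficient.\<close>
        then show ?thesis
          by (intro exI[of _ "d(k := s)"]) (use s in \<open>simp only: ext, simp add: r_def\<close>)
      next
        case False
        then obtain c where "AE x in lebesgue_on \<Omega>. g b' x = (\<Sum>i<k. c i *\<^sub>R e i x)"
          using span b' by auto
        then show ?thesis
          by (intro exI[of _ "c(k := 0)"]) (simp only: ext, simp)
      qed
    qed
  qed
qed

text \<open>Equivalence of norms on a finite-dimensional space, in a pointwise form.\<close>

lemma L2_span_pointwise_bound:
  fixes g :: "'b \<Rightarrow> real^'d \<Rightarrow> 'e::euclidean_space"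
  assumes "finite B" "\<forall>b\<in>B. g b \<in> L2 \<Omega>"
  obtains G :: "real^'d \<Rightarrow> real" where "G \<in> L2 \<Omega>" "\<And>x. 0 \<le> G x"
    "\<And>h c. \<lbrakk>h \<in> L2 \<Omega>; AE x in lebesgue_on \<Omega>. h x = (\<Sum>b\<in>B. c b *\<^sub>R g b x)\<rbrakk> \<Longrightarrow>
      AE x in lebesgue_on \<Omega>. norm (h x) \<le> sqrt (L2_inner \<Omega> h h) * G x"
proof -
  obtain k :: nat and e where e: "\<And>i. i < k \<Longrightarrow> e i \<in> L2 \<Omega>"
    and orth: "\<And>i j. i < k \<Longrightarrow> j < k \<Longrightarrow> L2_inner \<Omega> (e i) (e j) = (if i = j then 1 else 0)"
    and span: "\<And>b. b \<in> B \<Longrightarrow> \<exists>d. AE x in lebesgue_on \<Omega>. g b x = (\<Sum>i<k. d i *\<^sub>R e i x)"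
  proof -
    from L2_orthonormal_system[OF assms] obtain k :: nat and e where "(\<forall>i<k. e i \<in> L2 \<Omega>) \<and>
      (\<forall>i<k. \<forall>j<k. L2_inner \<Omega> (e i) (e j) = (if i = j then 1 else 0)) \<and>
      (\<forall>b\<in>B. \<exists>d. AE x in lebesgue_on \<Omega>. g b x = (\<Sum>i<k. d i *\<^sub>R e i x))"
      by blast
    then show ?thesis by (intro that[of k e]) blast+
  qed
  from span have "\<exists>d. \<forall>b\<in>B. AE x in lebesgue_on \<Omega>. g b x = (\<Sum>i<k. d b i *\<^sub>R e i x)"
    by (intro bchoice) blast
  then obtain d where d: "\<And>b. b \<in> B \<Longrightarrow> AE x in lebesgue_on \<Omega>. g b x = (\<Sum>i<k. d b i *\<^sub>R e i x)"
    by blast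
  show ?thesis
  \<comment> \<open>The dominating function is the sum of the pointwise norms of the orthonormal
    fields: the coefficients of \<open>h\<close> are inner products with unit fields, hence bounded
    by the norm of \<open>h\<close>.\<close>
  proof (rule that[of "\<lambda>x. \<Sum>i<k. norm (e i x)"])
    show "(\<lambda>x. \<Sum>i<k. norm (e i x)) \<in> L2 \<Omega>" using e by (intro L2_sum L2_norm) auto
    show "0 \<le> (\<Sum>i<k. norm (e i x))" for x by (simp add: sum_nonneg)
    fix h c assume h: "h \<in> L2 \<Omega>" and hc: "AE x in lebesgue_on \<Omega>. h x = (\<Sum>b\<in>B. c b *\<^sub>R g b x)"
    define D where "D i = (\<Sum>b\<in>B. c b * d b i)" for i
    have "AE x in lebesgue_on \<Omega>. \<forall>b\<in>B. g b x = (\<Sum>i<k. d b i *\<^sub>R e i x)"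
      using d assms(1) by (simp add: AE_finite_all)
    with hc have hD: "AE x in lebesgue_on \<Omega>. h x = (\<Sum>i<k. D i *\<^sub>R e i x)"
    proof eventually_elim
      case (elim x)
      have "h x = (\<Sum>b\<in>B. \<Sum>i<k. (c b * d b i) *\<^sub>R e i x)"
        using elim by (simp add: scaleR_sum_right)
      also have "\<dots> = (\<Sum>i<k. D i *\<^sub>R e i x)"
        by (subst sum.swap) (simp add: D_def scaleR_sum_left)
      finally show ?case .
    qed
    have D_le: "\<bar>D j\<bar> \<le> sqrt (L2_inner \<Omega> h h)" if j: "j < k" for j
    proof -
      have "L2_inner \<Omega> h (e j) = L2_inner \<Omega> (\<lambda>x. \<Sum>i<k. D i *\<^sub>R e i x) (e j)"
        using h e j hD by (intro L2_inner_cong_AE L2_sum L2_scaleR) auto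
      also have "\<dots> = (\<Sum>i<k. D i * L2_inner \<Omega> (e i) (e j))"
        using e j by (subst L2_inner_sum_left) (auto simp: L2_scaleR L2_inner_scaleR_left)
      also have "\<dots> = (\<Sum>i<k. if i = j then D i else 0)"
        using j by (intro sum.cong) (auto simp: orth)
      also have "\<dots> = D j" using j by simp
      finally have "(D j)\<^sup>2 \<le> L2_inner \<Omega> h h"
        using L2_Cauchy_Schwarz[OF h e[OF j]] orth[OF j j] by simp
      then have "sqrt ((D j)\<^sup>2) \<le> sqrt (L2_inner \<Omega> h h)" by (rule real_sqrt_le_mono)
      then show ?thesis by simp
    qed
    from hD show "AE x in lebesgue_on \<Omega>. norm (h x) \<le> sqrt (L2_inner \<Omega> h h) * (\<Sum>i<k. norm (e i x))"
    proof eventually_elim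
      case (elim x)
      have "norm (h x) \<le> (\<Sum>i<k. \<bar>D i\<bar> * norm (e i x))"
        unfolding elim by (rule order_trans[OF norm_sum]) simp
      also have "\<dots> \<le> (\<Sum>i<k. sqrt (L2_inner \<Omega> h h) * norm (e i x))"
        by (intro sum_mono mult_right_mono D_le) auto
      finally show ?case by (simp add: sum_distrib_left)
    qed
  qed
qed

section \<open>Weak derivatives\<close>

lemma L2_const:
  fixes c :: "'b::euclidean_space"
  assumes "\<Omega> \<in> lmeasurable"
  shows "(\<lambda>x. c) \<in> L2 \<Omega>"
proof -
  interpret finite_measure "lebesgue_on \<Omega>"
    using assms by (rule finite_measure_lebesgue_on)
  show ?thesis by (simp add: L2_def)
qed

section \<open>Test functions and their derivatives\<close>

lemma test_functions_continuous: "\<psi> \<in> test_functions \<Omega> \<Longrightarrow> continuous_on UNIV \<psi>"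
  unfolding test_functions_def using C_k.simps(1) by blast

text \<open>Off the closed support the function vanishes on an open set, so its derivative vanishes
  there too and the support does not grow.\<close>

lemma test_functions_partial_deriv:
  assumes "\<psi> \<in> test_functions \<Omega>"
  shows "partial_deriv i \<psi> \<in> test_functions \<Omega>"
proof -
  let ?K = "closure {x. \<psi> x \<noteq> 0}"
  have zero: "partial_deriv i \<psi> x = 0" if "x \<notin> ?K" for x
  proof -
    have "((\<lambda>_. 0) has_derivative (\<lambda>_. 0)) (at x)" by simp
    then have "(\<psi> has_derivative (\<lambda>_. 0)) (at x)"
    proof (rule has_derivative_transform_within_open[where s = "- ?K"])
      show "0 = \<psi> y" if "y \<in> - ?K" for y
        using that closure_subset[of "{x. \<psi> x \<noteq> 0}"] by auto
    qed (use that in auto)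
    then show ?thesis unfolding partial_deriv_def by (simp flip: frechet_derivative_at)
  qed
  have "closure {x. partial_deriv i \<psi> x \<noteq> 0} \<subseteq> ?K"
    by (rule closure_minimal) (use zero in auto)
  moreover have "C_k k (partial_deriv i \<psi>)" for k
    using assms C_k.simps(2)[of k \<psi>] unfolding test_functions_def by blast
  ultimately show ?thesis
    using assms unfolding test_functions_def
    by (auto simp: compact_eq_bounded_closed elim: bounded_subset)
qed

lemma test_functions_subset_L2:
  assumes "\<Omega> \<in> lmeasurable" "\<psi> \<in> test_functions \<Omega>"
  shows "\<psi> \<in> L2 \<Omega>"
proof -
  let ?K = "closure {x. \<psi> x \<noteq> 0}"
  have "compact (\<psi> ` ?K)"
    using assms test_functions_continuous[OF assms(2)]
    by (intro compact_continuous_image) (auto simp: test_functions_def intro: continuous_on_subset)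
  then obtain B where B: "\<And>x. x \<in> ?K \<Longrightarrow> \<bar>\<psi> x\<bar> \<le> B"
    using compact_imp_bounded bounded_real by (metis image_eqI)
  \<comment> \<open>\<open>B\<close> is arbitrary if the support is empty; its absolute value is a
    valid bound everywhere.\<close>
  have "\<bar>\<psi> x\<bar> \<le> \<bar>B\<bar>" for x
    using B[of x] closure_subset[of "{x. \<psi> x \<noteq> 0}"] by (cases "\<psi> x = 0") force+
  moreover have "\<psi> \<in> borel_measurable (lebesgue_on \<Omega>)"
    using test_functions_continuous[OF assms(2)]
    by (intro measurable_restrict_space1 measurable_completion)
       (simp add: borel_measurable_continuous_onI)
  ultimately show ?thesis
    by (intro L2_dominated[OF L2_const[OF assms(1), of "1::real"], where c = "\<bar>B\<bar>"]) auto
qed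

section \<open>Uniqueness and linearity of weak derivatives\<close>

lemma H1_0_weak_partial:
  assumes "u \<in> H1_0 \<Omega>"
  shows "weak_partial \<Omega> i u \<in> L2 \<Omega>" "is_weak_partial \<Omega> i u (weak_partial \<Omega> i u)"
proof -
  have "\<exists>g. g \<in> L2 \<Omega> \<and> is_weak_partial \<Omega> i u g"
    using assms by (auto simp: H1_0_def H1_def)
  then have "weak_partial \<Omega> i u \<in> L2 \<Omega> \<and> is_weak_partial \<Omega> i u (weak_partial \<Omega> i u)"
    unfolding weak_partial_def by (rule someI_ex)
  then show "weak_partial \<Omega> i u \<in> L2 \<Omega>" "is_weak_partial \<Omega> i u (weak_partial \<Omega> i u)"
    by auto
qed

lemma H1_0_L2: "u \<in> H1_0 \<Omega> \<Longrightarrow> u \<in> L2 \<Omega>"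
  by (simp add: H1_0_def H1_def)

text \<open>The weak derivative of an element of \<open>H1_0\<close> is a limit of derivatives of test functions, and
  these are test functions themselves.  This makes weak derivatives unique without any mollifiers.\<close>

lemma weakly_zero_orthogonal_weak_partial:
  assumes \<Omega>: "\<Omega> \<in> lmeasurable" and u: "u \<in> H1_0 \<Omega>" and g: "g \<in> L2 \<Omega>"
    and zero: "\<And>\<psi>. \<psi> \<in> test_functions \<Omega> \<Longrightarrow> L2_inner \<Omega> g \<psi> = 0"
  shows "L2_inner \<Omega> g (weak_partial \<Omega> i u) = 0"
proof -
  let ?p = "weak_partial \<Omega> i u"
  obtain \<psi> where \<psi>: "\<And>k. \<psi> k \<in> test_functions \<Omega>"
    and lim: "(\<lambda>k. LINT x|lebesgue_on \<Omega>. (?p x - partial_deriv i (\<psi> k) x)\<^sup>2) \<longlonglongrightarrow> 0"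
    using u by (auto simp: H1_0_def)
  define d where "d k x = ?p x - partial_deriv i (\<psi> k) x" for k x
  have t: "partial_deriv i (\<psi> k) \<in> test_functions \<Omega>" for k
    by (intro test_functions_partial_deriv \<psi>)
  have p: "?p \<in> L2 \<Omega>" by (rule H1_0_weak_partial[OF u])
  have d: "d k \<in> L2 \<Omega>" for k
    unfolding d_def[abs_def] by (intro L2_diff p test_functions_subset_L2 \<Omega> t)
  \<comment> \<open>Since \<open>g\<close> annihilates the derivative of each test function,
    subtracting it from the weak derivative changes nothing, and Cauchy-Schwarz then bounds the
    pairing by a quantity tending to 0.\<close>
  have "(L2_inner \<Omega> g ?p)\<^sup>2 \<le> L2_inner \<Omega> g g * L2_inner \<Omega> (d k) (d k)" for k
  proof -
    have "L2_inner \<Omega> g ?p = L2_inner \<Omega> g (d k)"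
      unfolding d_def[abs_def]
      using L2_inner_diff_right[OF p test_functions_subset_L2[OF \<Omega> t] g] zero[OF t] by simp
    then show ?thesis using L2_Cauchy_Schwarz[OF g d] by simp
  qed
  then have le: "\<exists>N. \<forall>k\<ge>N. (L2_inner \<Omega> g ?p)\<^sup>2 \<le> L2_inner \<Omega> g g * L2_inner \<Omega> (d k) (d k)"
    by blast
  have lim': "(\<lambda>k. L2_inner \<Omega> g g * L2_inner \<Omega> (d k) (d k)) \<longlonglongrightarrow> L2_inner \<Omega> g g * 0"
    using lim by (intro tendsto_mult_left) (simp add: L2_inner_def d_def power2_eq_square)
  have "(L2_inner \<Omega> g ?p)\<^sup>2 \<le> L2_inner \<Omega> g g * 0"
    by (rule LIMSEQ_le_const[OF lim' le])
  then show ?thesis by simp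
qed

text \<open>Each weak derivative is an arbitrarily chosen representative, so linearity has to come
  from uniqueness. The failure \<open>g\<close> of linearity is weakly zero, hence orthogonal to the
  three weak derivatives of which it is a combination, hence to itself.\<close>

lemma weak_partial_linear:
  assumes \<Omega>: "\<Omega> \<in> lmeasurable" and u: "u \<in> H1_0 \<Omega>" and v: "v \<in> H1_0 \<Omega>" and w: "w \<in> H1_0 \<Omega>"
    and eq: "AE x in lebesgue_on \<Omega>. w x = \<alpha> * u x + \<beta> * v x"
  shows "AE x in lebesgue_on \<Omega>. weak_partial \<Omega> i w x = \<alpha> * weak_partial \<Omega> i u x + \<beta> * weak_partial \<Omega> i v x"
proof -
  let ?p = "weak_partial \<Omega> i"
  define g where "g x = (?p w x - \<alpha> *\<^sub>R ?p u x) - \<beta> *\<^sub>R ?p v x" for x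
  note p = H1_0_weak_partial[OF u, of i] H1_0_weak_partial[OF v, of i] H1_0_weak_partial[OF w, of i]
  have su: "(\<lambda>x. \<alpha> *\<^sub>R ?p u x) \<in> L2 \<Omega>" and sv: "(\<lambda>x. \<beta> *\<^sub>R ?p v x) \<in> L2 \<Omega>"
    by (rule L2_scaleR[OF p(1)], rule L2_scaleR[OF p(3)])
  have g: "g \<in> L2 \<Omega>"
    unfolding g_def[abs_def] by (rule L2_diff[OF L2_diff[OF p(5) su] sv])
  have g_inner: "L2_inner \<Omega> h g = L2_inner \<Omega> h (?p w) - \<alpha> * L2_inner \<Omega> h (?p u) - \<beta> * L2_inner \<Omega> h (?p v)"
    if "h \<in> L2 \<Omega>" for h
    unfolding g_def[abs_def]
    by (simp only: L2_inner_diff_right[OF L2_diff[OF p(5) su] sv that]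
      L2_inner_diff_right[OF p(5) su that] L2_inner_scaleR_right)
  have zero: "L2_inner \<Omega> g \<psi> = 0" if \<psi>: "\<psi> \<in> test_functions \<Omega>" for \<psi>
  proof -
    let ?d = "partial_deriv i \<psi>"
    have L2: "\<psi> \<in> L2 \<Omega>" "?d \<in> L2 \<Omega>"
      by (intro test_functions_subset_L2 test_functions_partial_deriv \<Omega> \<psi>)+
    have parts: "L2_inner \<Omega> \<psi> (?p h) = - L2_inner \<Omega> h ?d" if "h \<in> H1_0 \<Omega>" for h
      using H1_0_weak_partial(2)[OF that, of i] \<psi>
      by (auto simp: is_weak_partial_def L2_inner_def mult.commute)
    have "L2_inner \<Omega> w ?d = L2_inner \<Omega> (\<lambda>x. \<alpha> *\<^sub>R u x + \<beta> *\<^sub>R v x) ?d"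
      using eq
      by (intro L2_inner_cong_AE L2_add L2_scaleR H1_0_L2[OF u] H1_0_L2[OF v] H1_0_L2[OF w] L2) auto
    also have "\<dots> = \<alpha> * L2_inner \<Omega> u ?d + \<beta> * L2_inner \<Omega> v ?d"
      by (simp only: L2_inner_add_left[OF L2_scaleR[OF H1_0_L2[OF u]] L2_scaleR[OF H1_0_L2[OF v]] L2(2)]
        L2_inner_scaleR_left)
    finally have "L2_inner \<Omega> \<psi> g = 0"
      using g_inner[OF L2(1)] parts u v w by simp
    then show ?thesis by (simp add: L2_inner_commute)
  qed
  have "L2_inner \<Omega> g g = 0"
    using g_inner[OF g] weakly_zero_orthogonal_weak_partial[OF \<Omega> _ g zero] u v w by simp
  from L2_inner_self_eq_0D[OF g this] show ?thesis
    by eventually_elim (simp add: g_def)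
qed

text \<open>Stated for entries in a general Euclidean space so that applying it twice covers matrix
  fields.\<close>

lemma L2_vec_lambda:
  fixes g :: "real^'d \<Rightarrow> 'n::finite \<Rightarrow> 'b::euclidean_space"
  assumes "\<And>i. (\<lambda>x. g x i) \<in> L2 \<Omega>"
  shows "(\<lambda>x. \<chi> i. g x i) \<in> L2 \<Omega>"
proof -
  have meas: "(\<lambda>x. \<chi> i. g x i) \<in> borel_measurable (lebesgue_on \<Omega>)"
  proof (subst borel_measurable_euclidean_space, rule ballI)
    fix c :: "'b^'n" assume "c \<in> Basis"
    then obtain i b where c: "c = axis i b" by (auto simp: Basis_vec_def)
    have "(\<lambda>x. g x i \<bullet> b) \<in> borel_measurable (lebesgue_on \<Omega>)"
      using L2_measurable[OF assms[of i]] by (rule borel_measurable_inner) simp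
    then show "(\<lambda>x. (\<chi> i. g x i) \<bullet> c) \<in> borel_measurable (lebesgue_on \<Omega>)"
      by (simp add: c inner_axis)
  qed
  have "(\<lambda>x. \<Sum>i\<in>UNIV. norm (g x i)) \<in> L2 \<Omega>" by (intro L2_sum L2_norm assms)
  then show ?thesis
    by (rule L2_dominated[where c = 1]) (auto intro!: meas L2_set_le_sum simp: norm_vec_def sum_nonneg)
qed

section \<open>Symmetric gradients\<close>

lemma V_L2: "u \<in> V \<Omega> \<Longrightarrow> u \<in> L2 \<Omega>"
  using L2_vec_lambda[of "\<lambda>x i. u x $ i" \<Omega>] by (auto simp: V_def intro: H1_0_L2)

lemma sym_grad_L2:
  assumes "u \<in> V \<Omega>"
  shows "sym_grad \<Omega> u \<in> L2 \<Omega>"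
proof -
  have "(\<lambda>x. (1/2) *\<^sub>R (weak_partial \<Omega> j (\<lambda>y. u y $ i) x + weak_partial \<Omega> i (\<lambda>y. u y $ j) x)) \<in> L2 \<Omega>" for i j
    using assms by (intro L2_scaleR L2_add H1_0_weak_partial) (auto simp: V_def)
  then show ?thesis unfolding sym_grad_def[abs_def] by (intro L2_vec_lambda) simp
qed

lemma sym_grad_linear:
  assumes \<Omega>: "\<Omega> \<in> lmeasurable" and V: "u \<in> V \<Omega>" "v \<in> V \<Omega>" "w \<in> V \<Omega>"
    and eq: "AE x in lebesgue_on \<Omega>. w x = \<alpha> *\<^sub>R u x + \<beta> *\<^sub>R v x"
  shows "AE x in lebesgue_on \<Omega>. sym_grad \<Omega> w x = \<alpha> *\<^sub>R sym_grad \<Omega> u x + \<beta> *\<^sub>R sym_grad \<Omega> v x"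
proof -
  let ?p = "\<lambda>u i j x. weak_partial \<Omega> i (\<lambda>y. u y $ j) x"
  have "AE x in lebesgue_on \<Omega>. ?p w i j x = \<alpha> * ?p u i j x + \<beta> * ?p v i j x" for i j
    by (rule weak_partial_linear[OF \<Omega>]) (use V eq in \<open>auto simp: V_def elim!: eventually_mono\<close>)
  then have "AE x in lebesgue_on \<Omega>. \<forall>i\<in>UNIV. \<forall>j\<in>UNIV. ?p w i j x = \<alpha> * ?p u i j x + \<beta> * ?p v i j x"
    by (intro AE_finite_allI finite)
  then show ?thesis
    by eventually_elim (simp add: sym_grad_def vec_eq_iff algebra_simps)
qed

section \<open>Measurability of the coefficients\<close>

locale viscous_problem =
  fixes \<Omega> :: "(real^'d) set" and f :: "real^'d \<Rightarrow> real^'d"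
    and \<mu> \<mu>' :: "real^'d \<Rightarrow> real \<Rightarrow> real" and m M :: real
    and W :: "(real^'d \<Rightarrow> real^'d) set"
  assumes open_domain: "open \<Omega>" and bounded_domain: "bounded \<Omega>" and domain_nonempty: "\<Omega> \<noteq> {}"
    and f_L2: "f \<in> L2 \<Omega>"
    and visc_continuous: "continuous_on (closure \<Omega> \<times> {0..}) (\<lambda>(x, t). \<mu> x t)"
    and profile: "x \<in> \<Omega> \<Longrightarrow> viscosity_profile (\<mu> x) (\<mu>' x) m M"
    and W: "finite_dim_subspace_V \<Omega> W"
begin

abbreviation "e \<equiv> sym_grad \<Omega>"

lemma lmeasurable_domain: "\<Omega> \<in> lmeasurable"
  using open_domain bounded_domain by (intro bounded_set_imp_lmeasurable) auto

lemma m_pos: "0 < m" and m_le_M: "m \<le> M"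
proof -
  obtain x where "x \<in> \<Omega>" using domain_nonempty by auto
  then interpret viscosity_profile "\<mu> x" "\<mu>' x" m M by (rule profile)
  show "0 < m" "m \<le> M" using m_pos flux_deriv_bounds[of 0] by simp_all
qed

lemma M_pos: "0 < M"
  using m_pos m_le_M by simp

text \<open>Lets an almost-everywhere statement that does not mention the point be read as a plain
  statement; this bounds the essential supremum from below.\<close>

lemma emeasure_domain: "emeasure (lebesgue_on \<Omega>) (space (lebesgue_on \<Omega>)) \<noteq> 0"
  using open_not_negligible[OF open_domain domain_nonempty] open_domain
  by (auto simp: emeasure_restrict_space negligible_iff_null_sets null_sets_def)

text \<open>Continuity holds only on a closed set; extension by zero makes the viscosity Borel on
  the whole product, so it can be composed with measurable arguments.\<close>

lemma visc_measurable_pair: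
  "(\<lambda>p. indicator (closure \<Omega> \<times> {0..}) p *\<^sub>R (case p of (x, t) \<Rightarrow> \<mu> x t)) \<in> borel_measurable borel"
  by (intro borel_measurable_continuous_on_indicator visc_continuous borel_closed closed_Times) auto

lemma ident_measurable: "(\<lambda>x. x) \<in> borel_measurable (lebesgue_on \<Omega>)"
  by (intro measurable_restrict_space1 measurable_completion) simp

lemma visc_measurable:
  assumes s: "s \<in> borel_measurable (lebesgue_on \<Omega>)" and nonneg: "\<And>x. x \<in> \<Omega> \<Longrightarrow> 0 \<le> s x"
  shows "(\<lambda>x. \<mu> x (s x)) \<in> borel_measurable (lebesgue_on \<Omega>)"
proof -
  have "(\<lambda>x. (x, s x)) \<in> borel_measurable (lebesgue_on \<Omega>)"
    by (intro borel_measurable_Pair ident_measurable s)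
  from measurable_compose[OF this visc_measurable_pair]
  have *: "(\<lambda>x. indicator (closure \<Omega> \<times> {0..}) (x, s x) *\<^sub>R \<mu> x (s x)) \<in> borel_measurable (lebesgue_on \<Omega>)"
    by simp
  have "(x, s x) \<in> closure \<Omega> \<times> {0..}" if "x \<in> \<Omega>" for x
    using that nonneg closure_subset by blast
  then show ?thesis
    by (intro measurable_cong[THEN iffD2, OF _ *]) simp
qed

text \<open>(A1) gives continuity of the derivative in \<open>t\<close> only, so joint measurability
  comes from writing it as a limit of difference quotients. The positive increments
  \<open>1/(k+1)\<close> keep the arguments in the half-line.\<close>

lemma visc_deriv_measurable:
  assumes s: "s \<in> borel_measurable (lebesgue_on \<Omega>)" and nonneg: "\<And>x. x \<in> \<Omega> \<Longrightarrow> 0 \<le> s x"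
  shows "(\<lambda>x. \<mu>' x (s x)) \<in> borel_measurable (lebesgue_on \<Omega>)"
proof (rule borel_measurable_LIMSEQ_real)
  let ?t = "\<lambda>k x. s x + inverse (real (Suc k))"
  let ?q = "\<lambda>k x. (\<mu> x (?t k x) - \<mu> x (s x)) / (?t k x - s x)"
  show "?q k \<in> borel_measurable (lebesgue_on \<Omega>)" for k
    using s nonneg
    by (intro borel_measurable_divide borel_measurable_diff visc_measurable borel_measurable_add) auto
  fix x assume "x \<in> space (lebesgue_on \<Omega>)"
  then have x: "x \<in> \<Omega>" by simp
  interpret viscosity_profile "\<mu> x" "\<mu>' x" m M by (rule profile[OF x])
  have "filterlim (\<lambda>k. ?t k x) (at (s x) within {0..}) sequentially"
    unfolding filterlim_at
  proof
    show "((\<lambda>k. ?t k x) \<longlonglongrightarrow> s x)"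
      using tendsto_add[OF tendsto_const LIMSEQ_inverse_real_of_nat, of "s x"] by simp
  qed (use nonneg[OF x] in auto)
  moreover have "((\<lambda>y. (\<mu> x y - \<mu> x (s x)) / (y - s x)) \<longlongrightarrow> \<mu>' x (s x)) (at (s x) within {0..})"
    using has_deriv[OF nonneg[OF x]] by (simp add: has_field_derivative_iff)
  ultimately show "(\<lambda>k. ?q k x) \<longlonglongrightarrow> \<mu>' x (s x)"
    by (rule filterlim_compose[rotated])
qed

text \<open>The variable upper limit is moved into an indicator on the product space; measurability
  of parameter integrals over a sigma-finite measure then applies.\<close>

lemma potential_measurable:
  assumes s: "s \<in> borel_measurable (lebesgue_on \<Omega>)" and nonneg: "\<And>x. x \<in> \<Omega> \<Longrightarrow> 0 \<le> s x"
  shows "(\<lambda>x. potential (\<mu> x) (s x)) \<in> borel_measurable (lebesgue_on \<Omega>)"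
proof -
  let ?F = "\<lambda>p. indicator (closure \<Omega> \<times> {0..}) p *\<^sub>R (case p of (x, t) \<Rightarrow> \<mu> x t)"
  let ?P = "lebesgue_on \<Omega> \<Otimes>\<^sub>M (lborel :: real measure)"
  have fst_m: "(\<lambda>p. fst p) \<in> borel_measurable ?P"
    by (rule measurable_compose[OF measurable_fst ident_measurable])
  have snd_m: "(\<lambda>p. snd p :: real) \<in> borel_measurable ?P" by simp
  have sm: "(\<lambda>p. s (fst p)) \<in> borel_measurable ?P"
    by (rule measurable_compose[OF measurable_fst s])
  have "(\<lambda>p. (fst p, snd p)) \<in> borel_measurable ?P"
    by (intro borel_measurable_Pair fst_m snd_m)
  from measurable_compose[OF this visc_measurable_pair]
  have Fm: "?F \<in> borel_measurable ?P" by simp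
  have "{p \<in> space ?P. 0 \<le> snd p \<and> snd p \<le> s (fst p)} \<in> sets ?P"
    using sm snd_m by measurable
  then have "(\<lambda>p. indicator {p \<in> space ?P. 0 \<le> snd p \<and> snd p \<le> s (fst p)} p *\<^sub>R ?F p) \<in> borel_measurable ?P"
    by (intro borel_measurable_scaleR Fm borel_measurable_indicator)
  then have "(\<lambda>(x, t). indicator {p \<in> space ?P. 0 \<le> snd p \<and> snd p \<le> s (fst p)} (x, t) *\<^sub>R ?F (x, t))
      \<in> borel_measurable ?P"
    by (simp add: case_prod_beta')
  from lborel.borel_measurable_lebesgue_integral[OF this]
  have *: "(\<lambda>x. (1/2) * (LINT t|lborel. indicator {p \<in> space ?P. 0 \<le> snd p \<and> snd p \<le> s (fst p)} (x, t) *\<^sub>R ?F (x, t)))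
      \<in> borel_measurable (lebesgue_on \<Omega>)"
    by (intro borel_measurable_times) auto
  have "potential (\<mu> x) (s x) =
      (1/2) * (LINT t|lborel. indicator {p \<in> space ?P. 0 \<le> snd p \<and> snd p \<le> s (fst p)} (x, t) *\<^sub>R ?F (x, t))"
    if x: "x \<in> \<Omega>" for x
  proof -
    interpret viscosity_profile "\<mu> x" "\<mu>' x" m M by (rule profile[OF x])
    have "continuous_on {0..s x} (\<mu> x)" by (rule continuous_on_subset[OF continuous]) auto
    then have "set_integrable lborel {0..s x} (\<mu> x)" by (rule borel_integrable_atLeastAtMost')
    then have "integral {0..s x} (\<mu> x) = (LINT t:{0..s x}|lborel. \<mu> x t)"
      by (rule set_borel_integral_eq_integral(2)[symmetric])
    also have "\<dots> = (LINT t|lborel. indicator {p \<in> space ?P. 0 \<le> snd p \<and> snd p \<le> s (fst p)} (x, t) *\<^sub>R ?F (x, t))"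
      unfolding set_lebesgue_integral_def
      using x closure_subset[of \<Omega>] 
      by (intro Bochner_Integration.integral_cong) (auto simp: space_pair_measure subset_iff split: split_indicator)
    finally show ?thesis by (simp add: potential_def)
  qed
  then show ?thesis
    by (intro measurable_cong[THEN iffD2, OF _ *]) simp
qed

lemma norm_square_measurable:
  assumes "g \<in> L2 \<Omega>"
  shows "(\<lambda>x. (norm (g x))\<^sup>2) \<in> borel_measurable (lebesgue_on \<Omega>)"
  by (intro borel_measurable_power measurable_compose[OF L2_measurable[OF assms] borel_measurable_norm])

lemma flux_deriv_measurable:
  assumes "g \<in> L2 \<Omega>"
  shows "(\<lambda>x. flux_deriv (\<mu> x) (\<mu>' x) (norm (g x))) \<in> borel_measurable (lebesgue_on \<Omega>)"
  unfolding flux_deriv_def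
  by (intro borel_measurable_add borel_measurable_times visc_measurable visc_deriv_measurable
    norm_square_measurable[OF assms]) auto

lemma bregman_measurable:
  assumes "g \<in> L2 \<Omega>" "h \<in> L2 \<Omega>"
  shows "(\<lambda>x. bregman (\<mu> x) (g x) (h x)) \<in> borel_measurable (lebesgue_on \<Omega>)"
  unfolding bregman_def
  by (intro borel_measurable_diff borel_measurable_times visc_measurable potential_measurable
    norm_square_measurable[OF assms(1)] norm_square_measurable[OF assms(2)] borel_measurable_inner
    L2_measurable[OF assms(1)] L2_measurable[OF assms(2)]) auto

end

section \<open>Energy expansion\<close>

context viscous_problem
begin

definition load :: "(real^'d \<Rightarrow> real^'d) \<Rightarrow> real" where
  "load v = (LINT x|lebesgue_on \<Omega>. f x \<bullet> v x)"

text \<open>The weight is attached to the field, so that the algebra of \<open>visc_form\<close>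
  reduces to that of \<open>L2_inner\<close>.\<close>

definition stress :: "(real^'d \<Rightarrow> real^'d) \<Rightarrow> (real^'d \<Rightarrow> real^'d^'d) \<Rightarrow> real^'d \<Rightarrow> real^'d^'d" where
  "stress u g x = \<mu> x ((norm (e u x))\<^sup>2) *\<^sub>R g x"

definition visc_form ::
    "(real^'d \<Rightarrow> real^'d) \<Rightarrow> (real^'d \<Rightarrow> real^'d) \<Rightarrow> (real^'d \<Rightarrow> real^'d) \<Rightarrow> real" where
  "visc_form u v w = L2_inner \<Omega> (stress u (e v)) (e w)"

text \<open>The Gateaux derivative of the energy at \<open>u\<close> in direction \<open>v\<close>,
  given by its formula; no limit is ever taken.\<close>

definition energy_deriv :: "(real^'d \<Rightarrow> real^'d) \<Rightarrow> (real^'d \<Rightarrow> real^'d) \<Rightarrow> real" where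
  "energy_deriv u v = visc_form u u v - load v"

definition energy_gap :: "(real^'d \<Rightarrow> real^'d) \<Rightarrow> (real^'d \<Rightarrow> real^'d) \<Rightarrow> real" where
  "energy_gap u v = (LINT x|lebesgue_on \<Omega>. bregman (\<mu> x) (e u x) (e v x))"

section \<open>Algebra of the viscous form on the subspace\<close>

lemma W_V: "w \<in> W \<Longrightarrow> w \<in> V \<Omega>"
  and W_zero: "(\<lambda>x. 0) \<in> W"
  and W_add: "u \<in> W \<Longrightarrow> v \<in> W \<Longrightarrow> (\<lambda>x. u x + v x) \<in> W"
  and W_scaleR: "u \<in> W \<Longrightarrow> (\<lambda>x. c *\<^sub>R u x) \<in> W"
  using W unfolding finite_dim_subspace_V_def by blast+

lemma W_diff: "u \<in> W \<Longrightarrow> v \<in> W \<Longrightarrow> (\<lambda>x. u x - v x) \<in> W"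
  using W_add[OF _ W_scaleR[of v "-1"], of u] by simp

lemma e_L2: "w \<in> W \<Longrightarrow> e w \<in> L2 \<Omega>"
  by (intro sym_grad_L2 W_V)

lemma e_diff:
  assumes "u \<in> W" "v \<in> W"
  shows "AE x in lebesgue_on \<Omega>. e (\<lambda>x. u x - v x) x = e u x - e v x"
  using sym_grad_linear[OF lmeasurable_domain W_V W_V W_V, of u v "\<lambda>x. u x - v x" 1 "-1"] assms
  by (simp add: W_diff)

lemma e_scaleR:
  assumes "u \<in> W"
  shows "AE x in lebesgue_on \<Omega>. e (\<lambda>x. c *\<^sub>R u x) x = c *\<^sub>R e u x"
  using sym_grad_linear[OF lmeasurable_domain W_V W_V W_V, of u u "\<lambda>x. c *\<^sub>R u x" c 0] assms
  by (simp add: W_scaleR)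

lemma stress_L2:
  assumes u: "u \<in> W" and g: "g \<in> L2 \<Omega>"
  shows "stress u g \<in> L2 \<Omega>"
proof (rule L2_dominated[OF g])
  show "stress u g \<in> borel_measurable (lebesgue_on \<Omega>)"
    unfolding stress_def[abs_def]
    by (intro borel_measurable_scaleR visc_measurable norm_square_measurable e_L2 u L2_measurable[OF g]) auto
  show "AE x in lebesgue_on \<Omega>. norm (stress u g x) \<le> M * norm (g x)"
  proof (rule AE_I2)
    fix x assume "x \<in> space (lebesgue_on \<Omega>)"
    then interpret viscosity_profile "\<mu> x" "\<mu>' x" m M by (intro profile) simp
    show "norm (stress u g x) \<le> M * norm (g x)"
      using visc_lower[of "norm (e u x)"] visc_upper[of "norm (e u x)"] m_pos
      by (simp add: stress_def mult_right_mono)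
  qed
qed

lemma visc_form_diff_left:
  assumes "u \<in> W" "v \<in> W" "v' \<in> W" "w \<in> W"
  shows "visc_form u (\<lambda>x. v x - v' x) w = visc_form u v w - visc_form u v' w"
proof -
  have "visc_form u (\<lambda>x. v x - v' x) w = L2_inner \<Omega> (\<lambda>x. stress u (e v) x - stress u (e v') x) (e w)"
    unfolding visc_form_def
    using e_diff[OF assms(2,3)]
    by (intro L2_inner_cong_AE stress_L2 L2_diff e_L2 W_diff assms)
       (auto elim!: eventually_mono simp: stress_def scaleR_diff_right)
  also have "\<dots> = visc_form u v w - visc_form u v' w"
    unfolding visc_form_def by (intro L2_inner_diff_left stress_L2 e_L2 assms)
  finally show ?thesis .
qed

lemma visc_form_commute: "visc_form u v w = visc_form u w v"
  by (simp add: visc_form_def L2_inner_def stress_def inner_commute)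

lemma visc_form_diff_right:
  assumes "u \<in> W" "v \<in> W" "w \<in> W" "w' \<in> W"
  shows "visc_form u v (\<lambda>x. w x - w' x) = visc_form u v w - visc_form u v w'"
  using visc_form_diff_left[OF assms(1,3,4,2)] by (simp add: visc_form_commute[of u v])

lemma visc_form_scaleR_right:
  assumes "u \<in> W" "v \<in> W" "w \<in> W"
  shows "visc_form u v (\<lambda>x. c *\<^sub>R w x) = c * visc_form u v w"
proof -
  have "visc_form u v (\<lambda>x. c *\<^sub>R w x) = L2_inner \<Omega> (stress u (e v)) (\<lambda>x. c *\<^sub>R e w x)"
    unfolding visc_form_def
    by (intro L2_inner_cong_AE stress_L2 L2_scaleR e_L2 W_scaleR e_scaleR assms) auto
  then show ?thesis by (simp add: visc_form_def L2_inner_scaleR_right)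
qed

lemma visc_form_scaleR_diag:
  assumes "u \<in> W" "v \<in> W"
  shows "visc_form u (\<lambda>x. c *\<^sub>R v x) (\<lambda>x. c *\<^sub>R v x) = c\<^sup>2 * visc_form u v v"
proof -
  have "visc_form u (\<lambda>x. c *\<^sub>R v x) (\<lambda>x. c *\<^sub>R v x) = c * visc_form u (\<lambda>x. c *\<^sub>R v x) v"
    by (rule visc_form_scaleR_right[OF assms(1) W_scaleR[OF assms(2)] assms(2)])
  also have "visc_form u (\<lambda>x. c *\<^sub>R v x) v = c * visc_form u v v"
    unfolding visc_form_commute[of u "\<lambda>x. c *\<^sub>R v x"]
    by (rule visc_form_scaleR_right[OF assms(1) assms(2) assms(2)])
  finally show ?thesis by (simp add: power2_eq_square)
qed

lemma load_diff:
  assumes "u \<in> W" "v \<in> W"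
  shows "load (\<lambda>x. u x - v x) = load u - load v"
  using L2_inner_diff_right[OF V_L2[OF W_V[OF assms(1)]] V_L2[OF W_V[OF assms(2)]] f_L2]
  by (simp add: load_def L2_inner_def)

lemma load_scaleR: "load (\<lambda>x. c *\<^sub>R u x) = c * load u"
  by (simp add: load_def)

lemma energy_deriv_scaleR:
  "\<lbrakk>u \<in> W; v \<in> W\<rbrakk> \<Longrightarrow> energy_deriv u (\<lambda>x. c *\<^sub>R v x) = c * energy_deriv u v"
  by (simp add: energy_deriv_def visc_form_scaleR_right load_scaleR right_diff_distrib)

section \<open>Energy expansion and bounds on its remainder\<close>

lemma potential_integrable:
  assumes "u \<in> W"
  shows "integrable (lebesgue_on \<Omega>) (\<lambda>x. potential (\<mu> x) ((norm (e u x))\<^sup>2))"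
proof (rule Bochner_Integration.integrable_bound)
  show "integrable (lebesgue_on \<Omega>) (\<lambda>x. (1/2) * M * (norm (e u x))\<^sup>2)"
    using e_L2[OF assms] by (simp add: L2_def)
  show "(\<lambda>x. potential (\<mu> x) ((norm (e u x))\<^sup>2)) \<in> borel_measurable (lebesgue_on \<Omega>)"
    by (intro potential_measurable norm_square_measurable e_L2 assms) auto
  show "AE x in lebesgue_on \<Omega>. norm (potential (\<mu> x) ((norm (e u x))\<^sup>2)) \<le> norm ((1/2) * M * (norm (e u x))\<^sup>2)"
  proof (rule AE_I2)
    fix x assume "x \<in> space (lebesgue_on \<Omega>)"
    then interpret viscosity_profile "\<mu> x" "\<mu>' x" m M by (intro profile) simp
    show "norm (potential (\<mu> x) ((norm (e u x))\<^sup>2)) \<le> norm ((1/2) * M * (norm (e u x))\<^sup>2)"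
      using potential_bounds[of "(norm (e u x))\<^sup>2"] by simp
  qed
qed

lemma bregman_integrable:
  assumes "u \<in> W" "v \<in> W"
  shows "integrable (lebesgue_on \<Omega>) (\<lambda>x. bregman (\<mu> x) (e u x) (e v x))"
proof -
  have "integrable (lebesgue_on \<Omega>) (\<lambda>x. stress u (e u) x \<bullet> (e v x - e u x))"
    by (intro L2_inner_integrable stress_L2 L2_diff e_L2 assms)
  then show ?thesis
    unfolding bregman_def using assms
    by (intro Bochner_Integration.integrable_diff potential_integrable) (simp_all add: stress_def)
qed

text \<open>An exact identity: \<open>bregman\<close> is the increment of the density minus its
  linear part, and the load is linear.\<close>

lemma energy_expansion:
  assumes u: "u \<in> W" and v: "v \<in> W"
  shows "energy \<Omega> \<mu> f v = energy \<Omega> \<mu> f u + energy_deriv u (\<lambda>x. v x - u x) + energy_gap u v"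
proof -
  have "energy_gap u v = (LINT x|lebesgue_on \<Omega>. potential (\<mu> x) ((norm (e v x))\<^sup>2))
      - (LINT x|lebesgue_on \<Omega>. potential (\<mu> x) ((norm (e u x))\<^sup>2))
      - (LINT x|lebesgue_on \<Omega>. stress u (e u) x \<bullet> (e v x - e u x))"
    unfolding energy_gap_def bregman_def
    using L2_inner_integrable[OF stress_L2[OF u e_L2[OF u]] L2_diff[OF e_L2[OF v] e_L2[OF u]]]
      potential_integrable[OF u] potential_integrable[OF v]
    by (simp add: stress_def)
  moreover have "(LINT x|lebesgue_on \<Omega>. stress u (e u) x \<bullet> (e v x - e u x)) = visc_form u u (\<lambda>x. v x - u x)"
    unfolding visc_form_def L2_inner_def[symmetric]
    using e_diff[OF v u]
    by (intro L2_inner_cong_AE stress_L2 L2_diff e_L2 W_diff u v) (auto elim!: eventually_mono)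
  moreover have "energy \<Omega> \<mu> f w = (LINT x|lebesgue_on \<Omega>. potential (\<mu> x) ((norm (e w x))\<^sup>2)) - load w" for w
    by (simp add: energy_def energy_density_def potential_def load_def)
  ultimately show ?thesis
    by (simp add: energy_deriv_def load_diff u v)
qed

lemma V_norm_square: "(V_norm \<Omega> w)\<^sup>2 = L2_inner \<Omega> (e w) (e w)"
  using L2_inner_self_nonneg[of \<Omega> "e w"] by (simp add: V_norm_def V_inner_def L2_inner_def)

lemma V_norm_square_diff:
  assumes "u \<in> W" "v \<in> W"
  shows "(V_norm \<Omega> (\<lambda>x. u x - v x))\<^sup>2 = (LINT x|lebesgue_on \<Omega>. (norm (e v x - e u x))\<^sup>2)"
proof -
  have "(V_norm \<Omega> (\<lambda>x. u x - v x))\<^sup>2 = L2_inner \<Omega> (\<lambda>x. e u x - e v x) (\<lambda>x. e u x - e v x)"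
    unfolding V_norm_square
    by (intro L2_inner_cong_AE e_diff e_L2 L2_diff W_diff assms)
  then show ?thesis by (simp add: L2_inner_self norm_minus_commute)
qed

lemma diff_square_integrable:
  assumes "u \<in> W" "v \<in> W"
  shows "integrable (lebesgue_on \<Omega>) (\<lambda>x. (norm (e v x - e u x))\<^sup>2)"
  using L2_diff[OF e_L2[OF assms(2)] e_L2[OF assms(1)]] by (simp add: L2_def)

lemma energy_gap_lower:
  assumes "u \<in> W" "v \<in> W"
  shows "(1/2) * m * (V_norm \<Omega> (\<lambda>x. u x - v x))\<^sup>2 \<le> energy_gap u v"
proof -
  have "(LINT x|lebesgue_on \<Omega>. (1/2) * m * (norm (e v x - e u x))\<^sup>2) \<le> energy_gap u v"
    unfolding energy_gap_def
  proof (rule integral_mono)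
    fix x assume "x \<in> space (lebesgue_on \<Omega>)"
    then interpret viscosity_profile "\<mu> x" "\<mu>' x" m M by (intro profile) simp
    show "(1/2) * m * (norm (e v x - e u x))\<^sup>2 \<le> bregman (\<mu> x) (e u x) (e v x)"
      by (rule bregman_lower)
  qed (use assms in \<open>auto intro!: bregman_integrable diff_square_integrable integrable_divide integrable_mult_right\<close>)
  then show ?thesis using V_norm_square_diff[OF assms] by simp
qed

lemma visc_form_diag_diff:
  assumes "w \<in> W" "u \<in> W" "v \<in> W"
  shows "visc_form w (\<lambda>x. u x - v x) (\<lambda>x. u x - v x)
      = (LINT x|lebesgue_on \<Omega>. \<mu> x ((norm (e w x))\<^sup>2) * (norm (e v x - e u x))\<^sup>2)"
    and "integrable (lebesgue_on \<Omega>) (\<lambda>x. \<mu> x ((norm (e w x))\<^sup>2) * (norm (e v x - e u x))\<^sup>2)"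
proof -
  let ?d = "\<lambda>x. e u x - e v x"
  have d: "?d \<in> L2 \<Omega>" by (intro L2_diff e_L2 assms)
  have "visc_form w (\<lambda>x. u x - v x) (\<lambda>x. u x - v x) = L2_inner \<Omega> (stress w ?d) ?d"
    unfolding visc_form_def
    using e_diff[OF assms(2,3)]
    by (intro L2_inner_cong_AE d e_L2 stress_L2 W_diff assms)
       (auto elim!: eventually_mono simp: stress_def)
  moreover have "stress w ?d x \<bullet> ?d x = \<mu> x ((norm (e w x))\<^sup>2) * (norm (e v x - e u x))\<^sup>2" for x
    unfolding norm_minus_commute[of "e v x"] by (simp add: stress_def power2_norm_eq_inner)
  ultimately show "visc_form w (\<lambda>x. u x - v x) (\<lambda>x. u x - v x)
      = (LINT x|lebesgue_on \<Omega>. \<mu> x ((norm (e w x))\<^sup>2) * (norm (e v x - e u x))\<^sup>2)"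
    "integrable (lebesgue_on \<Omega>) (\<lambda>x. \<mu> x ((norm (e w x))\<^sup>2) * (norm (e v x - e u x))\<^sup>2)"
    using L2_inner_integrable[OF stress_L2[OF assms(1) d] d] by (simp_all add: L2_inner_def)
qed

lemma energy_gap_upper:
  assumes "u \<in> W" "v \<in> W"
  shows "energy_gap u v \<le> (1/2) * visc_form u (\<lambda>x. u x - v x) (\<lambda>x. u x - v x)"
proof -
  note i = visc_form_diag_diff[OF assms(1,1,2)]
  have "energy_gap u v \<le> (LINT x|lebesgue_on \<Omega>. (1/2) * (\<mu> x ((norm (e u x))\<^sup>2) * (norm (e v x - e u x))\<^sup>2))"
    unfolding energy_gap_def
  proof (rule integral_mono)
    fix x assume "x \<in> space (lebesgue_on \<Omega>)"
    then interpret viscosity_profile "\<mu> x" "\<mu>' x" m M by (intro profile) simp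
    show "bregman (\<mu> x) (e u x) (e v x) \<le> (1/2) * (\<mu> x ((norm (e u x))\<^sup>2) * (norm (e v x - e u x))\<^sup>2)"
      using bregman_le_quadratic[of "e u x" "e v x"] by simp
  qed (use assms i(2) in \<open>auto intro: bregman_integrable\<close>)
  then show ?thesis by (simp add: i(1))
qed

lemma visc_form_diag_le:
  assumes "w \<in> W" "u \<in> W" "v \<in> W"
  shows "visc_form w (\<lambda>x. u x - v x) (\<lambda>x. u x - v x) \<le> M * (V_norm \<Omega> (\<lambda>x. u x - v x))\<^sup>2"
proof -
  have "visc_form w (\<lambda>x. u x - v x) (\<lambda>x. u x - v x) \<le> (LINT x|lebesgue_on \<Omega>. M * (norm (e v x - e u x))\<^sup>2)"
    unfolding visc_form_diag_diff(1)[OF assms]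
  proof (rule integral_mono)
    fix x assume "x \<in> space (lebesgue_on \<Omega>)"
    then interpret viscosity_profile "\<mu> x" "\<mu>' x" m M by (intro profile) simp
    show "\<mu> x ((norm (e w x))\<^sup>2) * (norm (e v x - e u x))\<^sup>2 \<le> M * (norm (e v x - e u x))\<^sup>2"
      by (intro mult_right_mono visc_upper) simp
  qed (use assms in \<open>auto intro: visc_form_diag_diff diff_square_integrable\<close>)
  then show ?thesis by (simp add: V_norm_square_diff[OF assms(2,3)])
qed

lemma visc_form_diag_nonneg:
  assumes "w \<in> W"
  shows "0 \<le> visc_form w v v"
  unfolding visc_form_def L2_inner_def
proof (rule integral_nonneg_AE, rule AE_I2)
  fix x assume "x \<in> space (lebesgue_on \<Omega>)"
  then interpret viscosity_profile "\<mu> x" "\<mu>' x" m M by (intro profile) simp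
  show "0 \<le> stress w (e v) x \<bullet> e v x"
    using visc_lower[of "norm (e w x)"] m_pos by (simp add: stress_def)
qed

text \<open>The quadratic majorant gives
  \<open>0 \<le> t * energy_deriv u v + t^2/2 * visc_form u v v\<close> for every real
  \<open>t\<close>. As there is no constant term, the discriminant forces the linear coefficient to
  vanish.\<close>

lemma minimizer_energy_deriv:
  assumes min: "is_arg_min (energy \<Omega> \<mu> f) (\<lambda>w. w \<in> W) u" and v: "v \<in> W"
  shows "energy_deriv u v = 0"
proof -
  have u: "u \<in> W" and le: "\<And>w. w \<in> W \<Longrightarrow> energy \<Omega> \<mu> f u \<le> energy \<Omega> \<mu> f w"
    using min by (auto simp: is_arg_min_linorder)
  have "(- (1/2) * energy_deriv u v)\<^sup>2 \<le> 0 * ((1/2) * visc_form u v v)"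
  proof (rule quadratic_nonneg_imp_discriminant)
    fix t :: real
    \<comment> \<open>Written as a difference, so that \<open>?w\<close> lies in \<open>W\<close> by
      \<open>W_diff\<close> and \<open>u - ?w\<close> simplifies to the scaled direction.\<close>
    let ?w = "\<lambda>x. u x - (- t) *\<^sub>R v x"
    have tv: "(\<lambda>x. (- t) *\<^sub>R v x) \<in> W" by (intro W_scaleR v)
    have w: "?w \<in> W" by (rule W_diff[OF u tv])
    have "energy_gap u ?w \<le> (1/2) * visc_form u (\<lambda>x. (- t) *\<^sub>R v x) (\<lambda>x. (- t) *\<^sub>R v x)"
      using energy_gap_upper[OF u w] by simp
    also have "visc_form u (\<lambda>x. (- t) *\<^sub>R v x) (\<lambda>x. (- t) *\<^sub>R v x) = t\<^sup>2 * visc_form u v v"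
      by (simp only: visc_form_scaleR_diag[OF u v] power2_minus)
    finally have gap: "energy_gap u ?w \<le> (1/2) * (t\<^sup>2 * visc_form u v v)" .
    have "(\<lambda>x. ?w x - u x) = (\<lambda>x. t *\<^sub>R v x)" by simp
    then have "energy_deriv u (\<lambda>x. ?w x - u x) = t * energy_deriv u v"
      by (simp only: energy_deriv_scaleR[OF u v])
    then have "0 \<le> t * energy_deriv u v + (1/2) * (t\<^sup>2 * visc_form u v v)"
      using energy_expansion[OF u w] le[OF w] gap by linarith
    then show "0 \<le> 0 - 2 * t * (- (1/2) * energy_deriv u v) + t\<^sup>2 * ((1/2) * visc_form u v v)"
      by simp
  qed
  then show ?thesis by simp
qed

text \<open>The right-hand side is the quadratic majorant of the energy at \<open>u\<close>. Its
  values at \<open>v\<close> and at \<open>d = u' - u\<close> differ by half of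
  \<open>visc_form u\<close> applied to \<open>v - d\<close>, so \<open>d\<close> minimises
  it.\<close>

lemma kacanov_step_optimal:
  assumes u: "u \<in> W" and u': "u' \<in> W" and v: "v \<in> W"
    and step: "\<And>v. v \<in> W \<Longrightarrow> visc_form u u' v = load v"
  shows "energy \<Omega> \<mu> f u' \<le> energy \<Omega> \<mu> f u + energy_deriv u v + (1/2) * visc_form u v v"
proof -
  define d where "d x = u' x - u x" for x
  have d: "d \<in> W" unfolding d_def[abs_def] by (intro W_diff u u')
  \<comment> \<open>The Kacanov equation says that \<open>d\<close> represents minus the energy
    derivative in the form weighted at \<open>u\<close>.\<close>
  have deriv: "energy_deriv u w = - visc_form u d w" if "w \<in> W" for w
    unfolding energy_deriv_def d_def[abs_def] using step[OF that]
    by (simp add: visc_form_diff_left[OF u u' u that])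
  have "(\<lambda>x. u x - u' x) = (\<lambda>x. (-1) *\<^sub>R d x)" by (simp add: d_def)
  then have "visc_form u (\<lambda>x. u x - u' x) (\<lambda>x. u x - u' x) = visc_form u d d"
    by (simp only: visc_form_scaleR_diag[OF u d]) simp
  then have "energy \<Omega> \<mu> f u' \<le> energy \<Omega> \<mu> f u + energy_deriv u d + (1/2) * visc_form u d d"
    using energy_expansion[OF u u'] energy_gap_upper[OF u u'] by (simp add: d_def[abs_def])
  moreover have "0 \<le> visc_form u (\<lambda>x. v x - d x) (\<lambda>x. v x - d x)"
    by (rule visc_form_diag_nonneg[OF u])
  then have "0 \<le> visc_form u v v - 2 * visc_form u d v + visc_form u d d"
    using u v d visc_form_commute[of u v d]
    by (simp add: visc_form_diff_left visc_form_diff_right W_diff)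
  ultimately show ?thesis using deriv[OF d] deriv[OF v] by simp
qed

text \<open>The optimal step is compared with the step \<open>\<theta>\<close> times
  \<open>w - u\<close>; convexity bounds the derivative in that direction by minus the energy
  difference. \<open>\<theta>\<close> stays free because it is chosen twice.\<close>

lemma kacanov_step_decrease:
  assumes u: "u \<in> W" and u': "u' \<in> W" and w: "w \<in> W"
    and step: "\<And>v. v \<in> W \<Longrightarrow> visc_form u u' v = load v" and \<theta>: "0 \<le> \<theta>"
  shows "energy \<Omega> \<mu> f u' \<le> energy \<Omega> \<mu> f u - \<theta> * (energy \<Omega> \<mu> f u - energy \<Omega> \<mu> f w)
      + (1/2) * \<theta>\<^sup>2 * visc_form u (\<lambda>x. w x - u x) (\<lambda>x. w x - u x)"
proof -
  define d where "d x = w x - u x" for x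
  have d: "d \<in> W" unfolding d_def[abs_def] by (intro W_diff u w)
  have "0 \<le> energy_gap u w"
    using m_pos by (intro order_trans[OF _ energy_gap_lower[OF u w]]) simp
  then have "energy_deriv u d \<le> - (energy \<Omega> \<mu> f u - energy \<Omega> \<mu> f w)"
    using energy_expansion[OF u w] by (simp add: d_def[abs_def])
  from mult_left_mono[OF this \<theta>]
  have "energy_deriv u (\<lambda>x. \<theta> *\<^sub>R d x) \<le> - \<theta> * (energy \<Omega> \<mu> f u - energy \<Omega> \<mu> f w)"
    by (simp add: energy_deriv_scaleR[OF u d] right_diff_distrib)
  moreover have "visc_form u (\<lambda>x. \<theta> *\<^sub>R d x) (\<lambda>x. \<theta> *\<^sub>R d x) = \<theta>\<^sup>2 * visc_form u d d"
    by (rule visc_form_scaleR_diag[OF u d])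
  ultimately show ?thesis
    using kacanov_step_optimal[OF u u' W_scaleR[OF d] step, of \<theta>] by (simp add: d_def[abs_def])
qed

end

section \<open>The Kacanov iteration\<close>

locale kacanov_iteration = viscous_problem \<Omega> f \<mu> \<mu>' m M W
  for \<Omega> :: "(real^'d) set" and f \<mu> \<mu>' m M W +
  fixes ustar :: "real^'d \<Rightarrow> real^'d" and u :: "nat \<Rightarrow> real^'d \<Rightarrow> real^'d"
  assumes minimiser: "is_arg_min (energy \<Omega> \<mu> f) (\<lambda>w. w \<in> W) ustar"
    and iterates: "kacanov_sequence \<Omega> \<mu> f W u"
begin

definition excess :: "nat \<Rightarrow> real" where
  "excess n = energy \<Omega> \<mu> f (u n) - energy \<Omega> \<mu> f ustar"

definition err :: "nat \<Rightarrow> real" where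
  "err n = (V_norm \<Omega> (\<lambda>x. ustar x - u n x))\<^sup>2"

section \<open>Linear convergence with a crude rate\<close>

lemma ustar_W: "ustar \<in> W"
  using minimiser by (simp add: is_arg_min_def)

lemma u_W: "u n \<in> W"
  using iterates by (simp add: kacanov_sequence_def)

lemma kacanov_equation: "v \<in> W \<Longrightarrow> visc_form (u n) (u (Suc n)) v = load v"
  using iterates by (simp add: kacanov_sequence_def visc_form_def L2_inner_def stress_def load_def)

lemma excess_nonneg: "0 \<le> excess n"
  using minimiser u_W[of n] by (simp add: excess_def is_arg_min_linorder)

lemma err_nonneg: "0 \<le> err n"
  by (simp add: err_def)

lemma err_integral: "err n = (LINT x|lebesgue_on \<Omega>. (norm (e (u n) x - e ustar x))\<^sup>2)"
  unfolding err_def by (rule V_norm_square_diff[OF ustar_W u_W])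

text \<open>Expanding at the minimiser, where the linear term vanishes, makes the excess a pure
  divergence based at \<open>ustar\<close>.\<close>

lemma excess_eq: "excess n = energy_gap ustar (u n)"
  using energy_expansion[OF ustar_W u_W[of n]]
    minimizer_energy_deriv[OF minimiser W_diff[OF u_W[of n] ustar_W]]
  by (simp add: excess_def)

lemma err_le_excess: "(1/2) * m * err n \<le> excess n"
  unfolding excess_eq err_def by (rule energy_gap_lower[OF ustar_W u_W])

lemma excess_step:
  assumes "0 \<le> \<theta>"
  shows "excess (Suc n) \<le> excess n - \<theta> * excess n
    + (1/2) * \<theta>\<^sup>2 * visc_form (u n) (\<lambda>x. ustar x - u n x) (\<lambda>x. ustar x - u n x)"
  using kacanov_step_decrease[OF u_W u_W ustar_W kacanov_equation assms, of n]
  by (simp add: excess_def)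

lemma excess_contraction: "excess (Suc n) \<le> (1 - m / (4 * M)) * excess n"
proof -
  \<comment> \<open>The minimiser of \<open>1 - \<theta> + \<theta>^2 * M / m\<close>, the factor
    obtained from \<open>visc_form \<le> M * err\<close> and
    \<open>err \<le> 2 * excess / m\<close>.\<close>
  define \<theta> where "\<theta> = m / (2 * M)"
  have \<theta>: "0 \<le> \<theta>" using m_pos M_pos by (simp add: \<theta>_def)
  have "visc_form (u n) (\<lambda>x. ustar x - u n x) (\<lambda>x. ustar x - u n x) \<le> M * err n"
    unfolding err_def by (rule visc_form_diag_le[OF u_W ustar_W u_W])
  also have "err n \<le> 2 * excess n / m"
    using err_le_excess[of n] m_pos by (simp add: field_simps)
  finally have "visc_form (u n) (\<lambda>x. ustar x - u n x) (\<lambda>x. ustar x - u n x) \<le> M * (2 * excess n / m)"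
    using M_pos by simp
  then have "(1/2) * \<theta>\<^sup>2 * visc_form (u n) (\<lambda>x. ustar x - u n x) (\<lambda>x. ustar x - u n x)
      \<le> (1/2) * \<theta>\<^sup>2 * (M * (2 * excess n / m))"
    by (intro mult_left_mono) auto
  also have "\<dots> = m / (4 * M) * excess n"
    using m_pos M_pos by (simp add: \<theta>_def field_simps power2_eq_square)
  finally have "excess (Suc n) \<le> excess n - \<theta> * excess n + m / (4 * M) * excess n"
    using excess_step[OF \<theta>, of n] by linarith
  also have "\<dots> = (1 - m / (4 * M)) * excess n"
    using M_pos by (simp add: \<theta>_def field_simps)
  finally show ?thesis .
qed

lemma err_tendsto_0: "err \<longlonglongrightarrow> 0"
proof -
  define q where "q = 1 - m / (4 * M)"
  have q: "0 \<le> q" "q < 1" using m_pos m_le_M M_pos by (auto simp: q_def field_simps)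
  have le: "excess n \<le> q ^ n * excess 0" for n
  proof (induction n)
    case (Suc n)
    have "excess (Suc n) \<le> q * excess n" using excess_contraction by (simp add: q_def)
    also have "\<dots> \<le> q * (q ^ n * excess 0)" by (intro mult_left_mono Suc q)
    finally show ?case by (simp add: mult.assoc)
  qed simp
  have upper: "err n \<le> (2 / m) * (q ^ n * excess 0)" for n
  proof -
    have "err n = (2 / m) * ((1/2) * m * err n)" using m_pos by simp
    also have "\<dots> \<le> (2 / m) * (q ^ n * excess 0)"
      using err_le_excess[of n] le[of n] m_pos by (intro mult_left_mono) (linarith, simp)
    finally show ?thesis .
  qed
  have "(\<lambda>n. (2 / m) * (q ^ n * excess 0)) \<longlonglongrightarrow> (2 / m) * (0 * excess 0)"
    using q by (intro tendsto_intros LIMSEQ_realpow_zero)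
  then have "(\<lambda>n. (2 / m) * (q ^ n * excess 0)) \<longlonglongrightarrow> 0" by simp
  from tendsto_sandwich[OF _ _ tendsto_const this] show ?thesis
    using upper err_nonneg by simp
qed

text \<open>Both claims are proved together: the induction step for the gradient needs the partial
  sum to lie in \<open>W\<close>.\<close>

lemma e_sum:
  assumes "finite B" "B \<subseteq> W"
  shows "(\<lambda>x. \<Sum>b\<in>B. c b *\<^sub>R b x) \<in> W \<and>
    (AE x in lebesgue_on \<Omega>. e (\<lambda>x. \<Sum>b\<in>B. c b *\<^sub>R b x) x = (\<Sum>b\<in>B. c b *\<^sub>R e b x))"
  using assms
proof (induction B)
  case empty
  have "AE x in lebesgue_on \<Omega>. e (\<lambda>x. 0) x = 0"
    using e_scaleR[OF W_zero, of 0] by simp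
  then show ?case by (simp add: W_zero)
next
  case (insert a B)
  define S where "S x = (\<Sum>b\<in>B. c b *\<^sub>R b x)" for x
  have S: "S \<in> W" "AE x in lebesgue_on \<Omega>. e S x = (\<Sum>b\<in>B. c b *\<^sub>R e b x)"
    using insert unfolding S_def[abs_def] by auto
  have a: "a \<in> W" using insert by simp
  have eq: "(\<lambda>x. \<Sum>b\<in>insert a B. c b *\<^sub>R b x) = (\<lambda>x. c a *\<^sub>R a x + S x)"
    using insert.hyps by (simp add: S_def)
  have in_W: "(\<lambda>x. c a *\<^sub>R a x + S x) \<in> W" by (intro W_add W_scaleR a S)
  have "AE x in lebesgue_on \<Omega>. e (\<lambda>x. c a *\<^sub>R a x + S x) x = c a *\<^sub>R e a x + 1 *\<^sub>R e S x"
    by (rule sym_grad_linear[OF lmeasurable_domain W_V[OF a] W_V[OF S(1)] W_V[OF in_W]]) simp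
  with S(2) have "AE x in lebesgue_on \<Omega>. e (\<lambda>x. c a *\<^sub>R a x + S x) x = (\<Sum>b\<in>insert a B. c b *\<^sub>R e b x)"
    by eventually_elim (use insert.hyps in simp)
  then show ?case using in_W by (simp only: eq)
qed

text \<open>One function \<open>G\<close> serves all iterates, because every error gradient lies in
  the span of the finitely many gradients \<open>e b\<close>.\<close>

lemma pointwise_bound:
  obtains G :: "real^'d \<Rightarrow> real" where "G \<in> L2 \<Omega>" "\<And>x. 0 \<le> G x"
    "\<And>n. AE x in lebesgue_on \<Omega>. norm (e (u n) x - e ustar x) \<le> sqrt (err n) * G x"
proof -
  obtain B where B: "finite B" "B \<subseteq> W"
    and span: "\<And>w. w \<in> W \<Longrightarrow> \<exists>c. AE x in lebesgue_on \<Omega>. w x = (\<Sum>b\<in>B. c b *\<^sub>R b x)"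
    using W unfolding finite_dim_subspace_V_def by blast
  have "\<forall>b\<in>B. e b \<in> L2 \<Omega>" using B e_L2 by blast
  then obtain G where G: "G \<in> L2 \<Omega>" "\<And>x. 0 \<le> G x"
    "\<And>h c. \<lbrakk>h \<in> L2 \<Omega>; AE x in lebesgue_on \<Omega>. h x = (\<Sum>b\<in>B. c b *\<^sub>R e b x)\<rbrakk> \<Longrightarrow>
      AE x in lebesgue_on \<Omega>. norm (h x) \<le> sqrt (L2_inner \<Omega> h h) * G x"
    by (rule L2_span_pointwise_bound[OF B(1)]) blast
  have "AE x in lebesgue_on \<Omega>. norm (e (u n) x - e ustar x) \<le> sqrt (err n) * G x" for n
  proof -
    let ?w = "\<lambda>x. ustar x - u n x"
    have w: "?w \<in> W" by (rule W_diff[OF ustar_W u_W])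
    obtain c where "AE x in lebesgue_on \<Omega>. ?w x = (\<Sum>b\<in>B. c b *\<^sub>R b x)" using span[OF w] by blast
    \<comment> \<open>The coefficients 1 and 0 merely bring the equality into the shape of
      \<open>sym_grad_linear\<close>, which carries almost-everywhere equality over to
      gradients.\<close>
    then have "AE x in lebesgue_on \<Omega>. ?w x = 1 *\<^sub>R (\<Sum>b\<in>B. c b *\<^sub>R b x) + 0 *\<^sub>R (\<Sum>b\<in>B. c b *\<^sub>R b x)"
      by simp
    from sym_grad_linear[OF lmeasurable_domain _ _ W_V[OF w] this] e_sum[OF B, of c]
    have "AE x in lebesgue_on \<Omega>. e ?w x = 1 *\<^sub>R e (\<lambda>x. \<Sum>b\<in>B. c b *\<^sub>R b x) x + 0 *\<^sub>R e (\<lambda>x. \<Sum>b\<in>B. c b *\<^sub>R b x) x"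
      by (blast intro: W_V)
    moreover have "AE x in lebesgue_on \<Omega>. e (\<lambda>x. \<Sum>b\<in>B. c b *\<^sub>R b x) x = (\<Sum>b\<in>B. c b *\<^sub>R e b x)"
      using e_sum[OF B] by blast
    ultimately have "AE x in lebesgue_on \<Omega>. e ?w x = (\<Sum>b\<in>B. c b *\<^sub>R e b x)"
      by eventually_elim simp
    from G(3)[OF e_L2[OF w] this] e_diff[OF ustar_W u_W, of n] show ?thesis
      by eventually_elim (simp add: err_def V_norm_square norm_minus_commute)
  qed
  then show ?thesis using that G by blast
qed

definition defect :: "nat \<Rightarrow> real^'d \<Rightarrow> real" where
  "defect n x = bregman_defect (\<mu> x) (\<mu>' x) (e ustar x) (e (u n) x)"

lemma defect_nonneg: "0 \<le> defect n x"
  by (simp add: defect_def bregman_defect_def)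

section \<open>The integrated defect is of higher order than the squared error\<close>

lemma defect_le:
  assumes "x \<in> \<Omega>"
  shows "defect n x \<le> (1/2) * M * (norm (e (u n) x - e ustar x))\<^sup>2"
proof -
  interpret viscosity_profile "\<mu> x" "\<mu>' x" m M by (rule profile[OF assms])
  show ?thesis unfolding defect_def by (rule bregman_defect_le)
qed

lemma diff_L2: "(\<lambda>x. e (u n) x - e ustar x) \<in> L2 \<Omega>"
  by (intro L2_diff e_L2 u_W ustar_W)

lemma defect_measurable: "defect n \<in> borel_measurable (lebesgue_on \<Omega>)"
  unfolding defect_def[abs_def] bregman_defect_def
  by (rule borel_measurable_max borel_measurable_diff borel_measurable_times borel_measurable_const
    flux_deriv_measurable[OF e_L2[OF u_W]] norm_square_measurable[OF diff_L2]
    bregman_measurable[OF e_L2[OF ustar_W] e_L2[OF u_W]])+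

lemma defect_integrable: "integrable (lebesgue_on \<Omega>) (defect n)"
proof (rule Bochner_Integration.integrable_bound)
  show "integrable (lebesgue_on \<Omega>) (\<lambda>x. (1/2) * M * (norm (e (u n) x - e ustar x))\<^sup>2)"
    using diff_square_integrable[OF ustar_W u_W[of n]] by simp
  show "AE x in lebesgue_on \<Omega>. norm (defect n x) \<le> norm ((1/2) * M * (norm (e (u n) x - e ustar x))\<^sup>2)"
    using defect_le defect_nonneg M_pos by (intro AE_I2) simp
qed (rule defect_measurable)

text \<open>Dominated convergence for \<open>defect / err\<close>: the majorant is a multiple of
  \<open>G^2\<close>, and the pointwise limit is 0 because the gradients converge almost
  everywhere.\<close>

lemma defect_small:
  assumes "0 < \<epsilon>"
  shows "\<exists>N. \<forall>n\<ge>N. (LINT x|lebesgue_on \<Omega>. defect n x) \<le> \<epsilon> * err n"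
proof -
  obtain G :: "real^'d \<Rightarrow> real" where G: "G \<in> L2 \<Omega>" "\<And>x. 0 \<le> G x"
    and bound: "\<And>n. AE x in lebesgue_on \<Omega>. norm (e (u n) x - e ustar x) \<le> sqrt (err n) * G x"
    by (rule pointwise_bound) blast
  \<comment> \<open>If \<open>err n = 0\<close> the quotient is 0 by convention; that case is
    treated separately at the end.\<close>
  define r where "r n x = defect n x / err n" for n x
  have "(\<lambda>n. LINT x|lebesgue_on \<Omega>. r n x) \<longlonglongrightarrow> (LINT x|lebesgue_on \<Omega>. 0)"
  proof (rule integral_dominated_convergence)
    show "r n \<in> borel_measurable (lebesgue_on \<Omega>)" for n
      unfolding r_def[abs_def]
      by (intro borel_measurable_divide defect_measurable borel_measurable_const)
    show "integrable (lebesgue_on \<Omega>) (\<lambda>x. (1/2) * M * (G x)\<^sup>2)"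
      using G(1) by (simp add: L2_def)
    \<comment> \<open>Used with \<open>c = M/2\<close> for the majorant and with small
      \<open>c\<close> for the pointwise limit.\<close>
    have *: "defect n x / err n \<le> c * (G x)\<^sup>2"
      if "defect n x \<le> c * (norm (e (u n) x - e ustar x))\<^sup>2"
        "norm (e (u n) x - e ustar x) \<le> sqrt (err n) * G x" "0 \<le> c" for c n x
    proof (cases "err n = 0")
      case True
      then show ?thesis using that by simp
    next
      case False
      then have pos: "0 < err n" using err_nonneg[of n] by simp
      have "(norm (e (u n) x - e ustar x))\<^sup>2 \<le> (sqrt (err n) * G x)\<^sup>2"
        using that(2) by (intro power_mono) auto
      also have "\<dots> = err n * (G x)\<^sup>2" using err_nonneg by (simp add: power_mult_distrib)
      finally have "defect n x \<le> c * (err n * (G x)\<^sup>2)"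
        using that(1,3) by (meson mult_left_mono order_trans)
      then show ?thesis using pos by (simp add: field_simps)
    qed
    show "AE x in lebesgue_on \<Omega>. norm (r n x) \<le> (1/2) * M * (G x)\<^sup>2" for n
      using bound[of n] AE_space
    proof eventually_elim
      case (elim x)
      then show ?case
        using *[OF defect_le elim(1)] M_pos defect_nonneg[of n x] err_nonneg[of n] by (simp add: r_def)
    qed
    \<comment> \<open>Countably many null sets are united so that one point \<open>x\<close> can be
      fixed for the whole sequence.\<close>
    have "AE x in lebesgue_on \<Omega>. \<forall>n. norm (e (u n) x - e ustar x) \<le> sqrt (err n) * G x"
      using bound by (simp add: AE_all_countable)
    then show "AE x in lebesgue_on \<Omega>. (\<lambda>n. r n x) \<longlonglongrightarrow> 0"
      using AE_space
    proof eventually_elim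
      case (elim x)
      then have x: "x \<in> \<Omega>" by simp
      interpret viscosity_profile "\<mu> x" "\<mu>' x" m M by (rule profile[OF x])
      have "(\<lambda>n. sqrt (err n) * G x) \<longlonglongrightarrow> sqrt 0 * G x"
        by (intro tendsto_intros err_tendsto_0)
      then have lim: "(\<lambda>n. sqrt (err n) * G x) \<longlonglongrightarrow> 0" by simp
      show ?case
      proof (rule LIMSEQ_I)
        fix \<eta> :: real assume "0 < \<eta>"
        \<comment> \<open>The added 1 keeps the denominator positive and makes
          \<open>c * (G x)^2\<close> strictly smaller than \<eta>.\<close>
        define c where "c = \<eta> / ((G x)\<^sup>2 + 1)"
        have G1: "0 < (G x)\<^sup>2 + 1" by (simp add: add_nonneg_pos)
        have c: "0 < c" using \<open>0 < \<eta>\<close> G1 by (simp add: c_def)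
        have "c * ((G x)\<^sup>2 + 1) = \<eta>" using G1 by (simp add: c_def)
        then have c_less: "c * (G x)\<^sup>2 < \<eta>" using c by (simp add: distrib_left)
        obtain \<delta> where \<delta>: "0 < \<delta>" "\<And>B. norm (B - e ustar x) < \<delta> \<Longrightarrow>
            bregman_defect (\<mu> x) (\<mu>' x) (e ustar x) B \<le> c * (norm (B - e ustar x))\<^sup>2"
          by (rule bregman_defect_small[OF c, of "e ustar x"]) blast
        have "\<forall>\<^sub>F n in sequentially. sqrt (err n) * G x < \<delta>"
          using order_tendstoD(2)[OF lim \<delta>(1)] .
        then obtain N where N: "\<And>n. n \<ge> N \<Longrightarrow> sqrt (err n) * G x < \<delta>"
          by (auto simp: eventually_sequentially)
        have "norm (r n x - 0) < \<eta>" if "n \<ge> N" for n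
        proof -
          have le: "norm (e (u n) x - e ustar x) \<le> sqrt (err n) * G x" using elim(1) by blast
          then have "norm (e (u n) x - e ustar x) < \<delta>" using N[OF that] by linarith
          from *[OF \<delta>(2)[OF this, folded defect_def] le] c
          have "r n x \<le> c * (G x)\<^sup>2" by (simp add: r_def)
          moreover have "0 \<le> r n x" using defect_nonneg err_nonneg by (simp add: r_def)
          ultimately show ?thesis using c_less by simp
        qed
        then show "\<exists>N. \<forall>n\<ge>N. norm (r n x - 0) < \<eta>" by blast
      qed
    qed
  qed simp
  then have "\<forall>\<^sub>F n in sequentially. (LINT x|lebesgue_on \<Omega>. r n x) < \<epsilon>"
    using order_tendstoD(2)[of _ 0 sequentially \<epsilon>] assms by simp
  then obtain N where N: "\<And>n. n \<ge> N \<Longrightarrow> (LINT x|lebesgue_on \<Omega>. r n x) < \<epsilon>"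
    by (auto simp: eventually_sequentially)
  have "(LINT x|lebesgue_on \<Omega>. defect n x) \<le> \<epsilon> * err n" if "n \<ge> N" for n
  proof (cases "err n = 0")
    \<comment> \<open>The quotient carries no information here; the bound by \<open>M/2\<close>
      times \<open>err n\<close> shows that the integral is at most 0.\<close>
    case True
    have "(LINT x|lebesgue_on \<Omega>. defect n x) \<le> (LINT x|lebesgue_on \<Omega>. (1/2) * M * (norm (e (u n) x - e ustar x))\<^sup>2)"
      using diff_square_integrable[OF ustar_W u_W[of n]]
      by (intro integral_mono defect_integrable) (simp_all add: defect_le[simplified])
    also have "\<dots> = (1/2) * M * err n" by (simp add: err_integral)
    finally show ?thesis using True by simp
  next
    case False
    then have "0 < err n" using err_nonneg[of n] by simp
    then show ?thesis using N[OF that] by (simp add: r_def field_simps)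
  qed
  then show ?thesis by blast
qed

section \<open>The contraction factor\<close>

lemma flux_deriv_form_le:
  "integrable (lebesgue_on \<Omega>) (\<lambda>x. flux_deriv (\<mu> x) (\<mu>' x) (norm (e (u n) x)) * (norm (e (u n) x - e ustar x))\<^sup>2)"
  "(LINT x|lebesgue_on \<Omega>. flux_deriv (\<mu> x) (\<mu>' x) (norm (e (u n) x)) * (norm (e (u n) x - e ustar x))\<^sup>2)
    \<le> 2 * excess n + 2 * (LINT x|lebesgue_on \<Omega>. defect n x)"
proof -
  let ?k = "\<lambda>x. flux_deriv (\<mu> x) (\<mu>' x) (norm (e (u n) x)) * (norm (e (u n) x - e ustar x))\<^sup>2"
  show int: "integrable (lebesgue_on \<Omega>) ?k"
  proof (rule Bochner_Integration.integrable_bound)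
    show "integrable (lebesgue_on \<Omega>) (\<lambda>x. M * (norm (e (u n) x - e ustar x))\<^sup>2)"
      using diff_square_integrable[OF ustar_W u_W[of n]] by simp
    show "?k \<in> borel_measurable (lebesgue_on \<Omega>)"
      by (intro borel_measurable_times flux_deriv_measurable[OF e_L2[OF u_W]] norm_square_measurable[OF diff_L2])
    show "AE x in lebesgue_on \<Omega>. norm (?k x) \<le> norm (M * (norm (e (u n) x - e ustar x))\<^sup>2)"
    proof (rule AE_I2)
      fix x assume "x \<in> space (lebesgue_on \<Omega>)"
      then interpret viscosity_profile "\<mu> x" "\<mu>' x" m M by (intro profile) simp
      show "norm (?k x) \<le> norm (M * (norm (e (u n) x - e ustar x))\<^sup>2)"
        using flux_deriv_bounds[of "norm (e (u n) x)"] m_pos by (simp add: abs_mult mult_right_mono)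
    qed
  qed
  note br = bregman_integrable[OF ustar_W u_W, of n]
  \<comment> \<open>This is what the defect was defined for: it pays for evaluating the flux
    derivative at the iterate.\<close>
  have "?k x \<le> 2 * bregman (\<mu> x) (e ustar x) (e (u n) x) + 2 * defect n x" for x
    by (simp add: defect_def bregman_defect_def max_def)
  then have "(LINT x|lebesgue_on \<Omega>. ?k x)
      \<le> (LINT x|lebesgue_on \<Omega>. 2 * bregman (\<mu> x) (e ustar x) (e (u n) x) + 2 * defect n x)"
    using br defect_integrable[of n]
    by (intro integral_mono int) simp_all
  also have "\<dots> = 2 * excess n + 2 * (LINT x|lebesgue_on \<Omega>. defect n x)"
    using br defect_integrable[of n] by (simp add: excess_eq energy_gap_def)
  finally show "(LINT x|lebesgue_on \<Omega>. ?k x) \<le> 2 * excess n + 2 * (LINT x|lebesgue_on \<Omega>. defect n x)" .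
qed

text \<open>The ratio lies in \<open>[1, M/m]\<close>, so its essential supremum is a real
  \<open>R\<close>; clearing the positive denominator gives the inequality between the two
  weights.\<close>

lemma q_A_ratio:
  assumes w: "w \<in> W"
  obtains R where "1 \<le> R" "q_A \<Omega> \<mu> \<mu>' w = 1 - 1 / (4 * R)"
    "AE x in lebesgue_on \<Omega>. \<mu> x ((norm (e w x))\<^sup>2) \<le> R * flux_deriv (\<mu> x) (\<mu>' x) (norm (e w x))"
proof -
  define \<kappa> where "\<kappa> x = flux_deriv (\<mu> x) (\<mu>' x) (norm (e w x))" for x
  define r where "r x = \<mu> x ((norm (e w x))\<^sup>2) / \<kappa> x" for x
  define S where "S = esssup (lebesgue_on \<Omega>) (\<lambda>x. ereal (r x))"
  have bounds: "0 < \<kappa> x" "1 \<le> r x" "r x \<le> M / m" if "x \<in> \<Omega>" for x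
  proof -
    interpret viscosity_profile "\<mu> x" "\<mu>' x" m M by (rule profile[OF that])
    note b = flux_deriv_bounds(1)[of "norm (e w x)", folded \<kappa>_def]
      flux_deriv_le[of "norm (e w x)", folded \<kappa>_def] visc_upper[of "norm (e w x)"] m_pos
    show pos: "0 < \<kappa> x" using b by simp
    show "1 \<le> r x" using b pos by (simp add: r_def)
    show "r x \<le> M / m" unfolding r_def using b by (intro frac_le) auto
  qed
  have "r \<in> borel_measurable (lebesgue_on \<Omega>)"
    unfolding r_def[abs_def] \<kappa>_def
    by (intro borel_measurable_divide visc_measurable flux_deriv_measurable norm_square_measurable e_L2 w) auto
  then have meas: "(\<lambda>x. ereal (r x)) \<in> borel_measurable (lebesgue_on \<Omega>)" by simp
  have "S \<le> ereal (M / m)"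
    unfolding S_def using bounds by (intro esssup_I meas AE_I2) simp
  \<comment> \<open>The claim does not involve \<open>x\<close>; positive measure of the domain then
    removes the quantifier.\<close>
  moreover have "AE x in lebesgue_on \<Omega>. 1 \<le> S"
    using esssup_AE[of "\<lambda>x. ereal (r x)" "lebesgue_on \<Omega>", folded S_def] AE_space
  proof eventually_elim
    case (elim x)
    then have "1 \<le> ereal (r x)" using bounds(2) by (simp add: one_ereal_def)
    then show ?case using elim(1) by (rule order_trans)
  qed
  then have "1 \<le> S"
    using emeasure_domain eventually_const[of "ae_filter (lebesgue_on \<Omega>)" "1 \<le> S"]
    by (simp add: ae_filter_eq_bot_iff)
  ultimately obtain R where R: "S = ereal R" "1 \<le> R" by (cases S) auto
  have "AE x in lebesgue_on \<Omega>. \<mu> x ((norm (e w x))\<^sup>2) \<le> R * \<kappa> x"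
    using esssup_AE[of "\<lambda>x. ereal (r x)" "lebesgue_on \<Omega>", folded S_def] AE_space
  proof eventually_elim
    case (elim x)
    then show ?case using R bounds(1)[of x] by (simp add: r_def field_simps)
  qed
  moreover have "q_A \<Omega> \<mu> \<mu>' w = 1 - 1 / (4 * R)"
  proof -
    have "(\<lambda>x. let s = (norm (e w x))\<^sup>2 in ereal (\<mu> x s / (2 * \<mu>' x s * s + \<mu> x s))) = (\<lambda>x. ereal (r x))"
      by (simp add: r_def \<kappa>_def flux_deriv_def Let_def fun_eq_iff)
    then have "q_A \<Omega> \<mu> \<mu>' w = 1 - (1/4) * inverse (real_of_ereal S)"
      unfolding q_A_def S_def by (simp only:)
    then show ?thesis by (simp add: R(1) inverse_eq_divide)
  qed
  ultimately show ?thesis using that R(2) by (simp add: \<kappa>_def)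
qed

lemma energy_contraction:
  "excess (Suc n) \<le> q_A \<Omega> \<mu> \<mu>' (u n) * excess n + (LINT x|lebesgue_on \<Omega>. defect n x)"
proof -
  let ?\<tau> = "LINT x|lebesgue_on \<Omega>. defect n x"
  obtain R where R: "1 \<le> R" "q_A \<Omega> \<mu> \<mu>' (u n) = 1 - 1 / (4 * R)"
    "AE x in lebesgue_on \<Omega>. \<mu> x ((norm (e (u n) x))\<^sup>2) \<le> R * flux_deriv (\<mu> x) (\<mu>' x) (norm (e (u n) x))"
    by (rule q_A_ratio[OF u_W])
  let ?a = "visc_form (u n) (\<lambda>x. ustar x - u n x) (\<lambda>x. ustar x - u n x)"
  note a = visc_form_diag_diff[OF u_W ustar_W u_W, of n n]
  have \<tau>: "0 \<le> ?\<tau>" by (simp add: defect_nonneg)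
  have "?a \<le> (LINT x|lebesgue_on \<Omega>. R * (flux_deriv (\<mu> x) (\<mu>' x) (norm (e (u n) x)) * (norm (e (u n) x - e ustar x))\<^sup>2))"
    unfolding a(1) norm_minus_commute[of "e (u n) _"]
  proof (rule integral_mono_AE)
    show "AE x in lebesgue_on \<Omega>. \<mu> x ((norm (e (u n) x))\<^sup>2) * (norm (e ustar x - e (u n) x))\<^sup>2
      \<le> R * (flux_deriv (\<mu> x) (\<mu>' x) (norm (e (u n) x)) * (norm (e ustar x - e (u n) x))\<^sup>2)"
      using R(3) by eventually_elim (simp add: mult_right_mono flip: mult.assoc)
  qed (use a(2) flux_deriv_form_le(1)[of n] in \<open>simp_all add: norm_minus_commute\<close>)
  also have "\<dots> \<le> R * (2 * excess n + 2 * ?\<tau>)"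
    using flux_deriv_form_le(2)[of n] R(1) by simp
  \<comment> \<open>Given the bound \<open>2 * R * (excess n + ?\<tau>)\<close> on
    \<open>?a\<close>, \<open>\<theta> = 1 / (2 * R)\<close> balances the linear gain against the
    quadratic loss: half of the gain survives.\<close>
  finally have "(1/2) * (1 / (2 * R))\<^sup>2 * ?a \<le> (1/2) * (1 / (2 * R))\<^sup>2 * (R * (2 * excess n + 2 * ?\<tau>))"
    by (intro mult_left_mono) auto
  also have "\<dots> = (excess n + ?\<tau>) / (4 * R)"
    using R(1) by (simp add: field_simps power2_eq_square)
  finally have le: "(1/2) * (1 / (2 * R))\<^sup>2 * ?a \<le> (excess n + ?\<tau>) / (4 * R)" .
  have "0 \<le> 1 / (2 * R)" using R(1) by simp
  from order_trans[OF excess_step[OF this] add_left_mono[OF le]]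
  have "excess (Suc n) \<le> excess n - 1 / (2 * R) * excess n + (excess n + ?\<tau>) / (4 * R)" .
  also have "\<dots> = q_A \<Omega> \<mu> \<mu>' (u n) * excess n + ?\<tau> / (4 * R)"
    using R(1) by (simp add: R(2) field_simps)
  also have "?\<tau> / (4 * R) \<le> ?\<tau>"
    using \<tau> R(1) mult_right_mono[of 1 "4 * R" ?\<tau>] by (simp add: divide_le_eq mult.commute)
  finally show ?thesis by simp
qed

end

theorem theorem3p4:
  fixes \<Omega> :: "(real^'d) set"
    and f ustar :: "real^'d \<Rightarrow> real^'d"
    and \<mu> \<mu>' :: "real^'d \<Rightarrow> real \<Rightarrow> real"
    and W :: "(real^'d \<Rightarrow> real^'d) set"
    and u :: "nat \<Rightarrow> real^'d \<Rightarrow> real^'d"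
  assumes "CARD('d) \<in> {2, 3}"
    and "bounded_lipschitz_domain \<Omega>"
    and "f \<in> L2 \<Omega>"
    and "viscosity_A1 \<Omega> \<mu> \<mu>'"
    and "viscosity_A2 \<Omega> \<mu>"
    and "viscosity_A3 \<Omega> \<mu>'"
    and "finite_dim_subspace_V \<Omega> W"
    and "is_arg_min (energy \<Omega> \<mu> f) (\<lambda>w. w \<in> W) ustar"
    and "kacanov_sequence \<Omega> \<mu> f W u"
  shows "\<exists>\<rho> :: nat \<Rightarrow> real.
    (\<forall>\<epsilon>>0. \<exists>N. \<forall>n\<ge>N. \<bar>\<rho> n\<bar> \<le> \<epsilon> * (V_norm \<Omega> (\<lambda>x. ustar x - u n x))\<^sup>2) \<and>
    (\<forall>n. 0 \<le> energy \<Omega> \<mu> f (u (Suc n)) - energy \<Omega> \<mu> f ustar \<and>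
         energy \<Omega> \<mu> f (u (Suc n)) - energy \<Omega> \<mu> f ustar
           \<le> q_A \<Omega> \<mu> \<mu>' (u n) * (energy \<Omega> \<mu> f (u n) - energy \<Omega> \<mu> f ustar) + \<rho> n)"
proof -
  obtain m M where m: "0 < m" and A2: "\<And>x s t. \<lbrakk>x \<in> closure \<Omega>; 0 \<le> s; s \<le> t\<rbrakk> \<Longrightarrow>
      m * (t - s) \<le> \<mu> x (t\<^sup>2) * t - \<mu> x (s\<^sup>2) * s \<and> \<mu> x (t\<^sup>2) * t - \<mu> x (s\<^sup>2) * s \<le> M * (t - s)"
    using assms(5) unfolding viscosity_A2_def by blast
  have profile: "viscosity_profile (\<mu> x) (\<mu>' x) m M" if "x \<in> \<Omega>" for x
  proof -
    have "x \<in> closure \<Omega>" using that closure_subset by blast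
    then show ?thesis
      using assms(4,6) m A2 by unfold_locales (auto simp: viscosity_A1_def viscosity_A3_def)
  qed
  interpret kacanov_iteration \<Omega> f \<mu> \<mu>' m M W ustar u
    by (intro kacanov_iteration.intro viscous_problem.intro kacanov_iteration_axioms.intro
        profile assms(3,7,8,9))
      (use assms(2,4) in \<open>simp_all add: bounded_lipschitz_domain_def viscosity_A1_def\<close>)
  show ?thesis
  \<comment> \<open>The remainder is the integrated defect.\<close>
  proof (intro exI[of _ "\<lambda>n. LINT x|lebesgue_on \<Omega>. defect n x"] conjI allI impI)
    fix \<epsilon> :: real assume "0 < \<epsilon>"
    moreover have "0 \<le> (LINT x|lebesgue_on \<Omega>. defect n x)" for n
      by (simp add: defect_nonneg)
    ultimately show "\<exists>N. \<forall>n\<ge>N. \<bar>LINT x|lebesgue_on \<Omega>. defect n x\<bar>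
        \<le> \<epsilon> * (V_norm \<Omega> (\<lambda>x. ustar x - u n x))\<^sup>2"
      using defect_small[of \<epsilon>] by (simp add: err_def)
  next
    fix n
    show "0 \<le> energy \<Omega> \<mu> f (u (Suc n)) - energy \<Omega> \<mu> f ustar"
      using excess_nonneg[of "Suc n"] by (simp add: excess_def)
    show "energy \<Omega> \<mu> f (u (Suc n)) - energy \<Omega> \<mu> f ustar
        \<le> q_A \<Omega> \<mu> \<mu>' (u n) * (energy \<Omega> \<mu> f (u n) - energy \<Omega> \<mu> f ustar)
          + (LINT x|lebesgue_on \<Omega>. defect n x)"
      using energy_contraction[of n] by (simp add: excess_def)
  qed
qed

end
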